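(* Let $A$ be a finite abelian group, and let $z\in A$ be an element with $z^2=e$ (the case $z=e$ is allowed). For every positive integer $m$, the pair $(G_{A,z},2m)$ is rate-monotonic. Explicitly: for all symmetric generating rate collections $\boldsymbol{\lambda},\boldsymbol{\lambda}'\in\mathbb{R}_{\ge 0}^{G_{A,z}}$ with $\boldsymbol{\lambda}\le\boldsymbol{\lambda}'$ and all real $t\ge 0$, one has $d_{2m}^{\boldsymbol{\lambda}}(t)\ge d_{2m}^{\boldsymbol{\lambda}'}(t)$.
   Context: For a finite abelian group $A$ and $z\in A$ with $z^2=e$, the inversion extension is the group $$G_{A,z}=\langle A,b\mid b^2=z,\ bab^{-1}=a^{-1}\text{ for every }a\in A\rangle$$ (the relations of $A$ are included). It has order $2|A|$, contains $A$ as a subgroup of index $2$, and every element has a unique expression of the form $a$ or $ab$ with $a\in A$. Let $G$ be a finite group with identity $e$. A rate collection is $\boldsymbol{\lambda}=(\lambda_s)_{s\in G}\in\mathbb{R}_{\ge 0}^G$. It is symmetric if $\lambda_s=\lambda_{s^{-1}}$ for all $s\in G$, and generating if its support $\{s\in G:\lambda_s>0\}$ generates $G$. Write $\boldsymbol{\lambda}\le\boldsymbol{\lambda}'$ if $\lambda_s\le\lambda'_s$ for all $s\in G$. The continuous-time random walk $(X_t^{\boldsymbol{\lambda}})_{t\ge 0}$ on $G$ driven by $\boldsymbol{\lambda}$ starts at $e$ at time $0$. Each $s\in G$ has an independent Poisson clock of rate $\lambda_s$, and whenever the clock of $s$ rings, the current state is multiplied by $s$ on the right (so it is the continuous-time Markov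 chain with jump rate $\lambda_s$ from $g$ to $gs$). Let $P_t^{\boldsymbol{\lambda}}(g)=\mathbb{P}(X_t^{\boldsymbol{\lambda}}=g)$. For $1\le p<\infty$, let $$d_p^{\boldsymbol{\lambda}}(t)=\Bigl(\sum_{g\in G}\bigl|P_t^{\boldsymbol{\lambda}}(g)-\tfrac{1}{|G|}\bigr|^p\Bigr)^{1/p}.$$ The pair $(G,p)$ is rate-monotonic if for all symmetric generating $\boldsymbol{\lambda},\boldsymbol{\lambda}'\in\mathbb{R}_{\ge 0}^G$ with $\boldsymbol{\lambda}\le\boldsymbol{\lambda}'$, one has $d_p^{\boldsymbol{\lambda}}(t)\ge d_p^{\boldsymbol{\lambda}'}(t)$ for all real $t\ge 0$. *)

theory Defs
  imports "HOL-Probability.Probability" "HOL-Algebra.Generated_Groups"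
begin

section \<open>Groups given by generators and relations\<close>

text \<open>The letter \<open>(x, True)\<close> stands for the generator \<open>x\<close> and \<open>(x, False)\<close> for its formal
  inverse.  A relation is a pair of words that are to become equal.\<close>

type_synonym 'g word = "('g \<times> bool) list"

definition words_over :: "'g set \<Rightarrow> 'g word set" where
  "words_over X = lists (X \<times> UNIV)"

inductive_set word_rel :: "'g set \<Rightarrow> ('g word \<times> 'g word) set \<Rightarrow> ('g word \<times> 'g word) set"
  for X :: "'g set" and R :: "('g word \<times> 'g word) set"
  where
    refl: "w \<in> words_over X \<Longrightarrow> (w, w) \<in> word_rel X R"
  | sym: "(u, v) \<in> word_rel X R \<Longrightarrow> (v, u) \<in> word_rel X R"
  | trans: "(u, v) \<in> word_rel X R \<Longrightarrow> (v, w) \<in> word_rel X R \<Longrightarrow> (u, w) \<in> word_rel X R"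
  | append: "(u, u') \<in> word_rel X R \<Longrightarrow> (v, v') \<in> word_rel X R
      \<Longrightarrow> (u @ v, u' @ v') \<in> word_rel X R"
  | cancel: "x \<in> X \<Longrightarrow> ([(x, i), (x, \<not> i)], []) \<in> word_rel X R"
  | relation: "(u, v) \<in> R \<Longrightarrow> u \<in> words_over X \<Longrightarrow> v \<in> words_over X \<Longrightarrow> (u, v) \<in> word_rel X R"

definition presented_group :: "'g set \<Rightarrow> ('g word \<times> 'g word) set \<Rightarrow> 'g word set monoid" where
  "presented_group X R =
    \<lparr>carrier = words_over X // word_rel X R,
     mult = (\<lambda>U V. \<Union>u\<in>U. \<Union>v\<in>V. word_rel X R `` {u @ v}),
     one = word_rel X R `` {[]}\<rparr>"

lemma word_rel_in_words:
  assumes "(u, v) \<in> word_rel X R"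
  shows "u \<in> words_over X \<and> v \<in> words_over X"
  using assms by induction (auto simp: words_over_def)

lemma equiv_word_rel: "equiv (words_over X) (word_rel X R)"
proof (rule equivI)
  show "word_rel X R \<subseteq> words_over X \<times> words_over X"
    using word_rel_in_words by fast
  show "refl_on (words_over X) (word_rel X R)"
    by (auto intro!: refl_onI word_rel.refl)
  show "sym (word_rel X R)"
    by (auto intro!: symI word_rel.sym)
  show "trans (word_rel X R)"
    by (auto intro!: transI intro: word_rel.trans)
qed

lemma presented_group_mult:
  assumes "u \<in> words_over X" "v \<in> words_over X"
  shows "word_rel X R `` {u} \<otimes>\<^bsub>presented_group X R\<^esub> word_rel X R `` {v} = word_rel X R `` {u @ v}"
proof -
  have "congruent2 (word_rel X R) (word_rel X R) (\<lambda>u v. word_rel X R `` {u @ v})"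
    by (auto intro!: congruent2I' equiv_class_eq[OF equiv_word_rel] word_rel.append)
  then show ?thesis
    using UN_equiv_class2[OF equiv_word_rel equiv_word_rel] assms
    by (simp add: presented_group_def)
qed

lemma word_rel_left_inverse:
  assumes "w \<in> words_over X"
  shows "(rev (map (\<lambda>(x, i). (x, \<not> i)) w) @ w, []) \<in> word_rel X R"
  using assms
proof (induction w)
  case Nil
  then show ?case by (auto intro: word_rel.refl)
next
  case (Cons l w)
  obtain x i where l: "l = (x, i)" by fastforce
  let ?v = "rev (map (\<lambda>(x, i). (x, \<not> i)) w)"
  have x: "x \<in> X" and w: "w \<in> words_over X" and v: "?v \<in> words_over X"
    using Cons.prems l by (auto simp: words_over_def)
  have "([(x, \<not> i), (x, i)], []) \<in> word_rel X R"
    using word_rel.cancel[OF x, of "\<not> i"] by simp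
  then have "(?v @ ([(x, \<not> i), (x, i)] @ w), ?v @ ([] @ w)) \<in> word_rel X R"
    using v w by (intro word_rel.append word_rel.refl)
  with Cons.IH[OF w] show ?case
    by (auto simp: l intro: word_rel.trans)
qed

lemma group_presented_group: "group (presented_group X R)"
proof (rule groupI)
  let ?G = "presented_group X R"
  have car: "carrier ?G = words_over X // word_rel X R"
    and one: "\<one>\<^bsub>?G\<^esub> = word_rel X R `` {[]}"
    by (simp_all add: presented_group_def)
  have nil: "[] \<in> words_over X" by (simp add: words_over_def)
  have app: "u @ v \<in> words_over X" if "u \<in> words_over X" "v \<in> words_over X" for u v
    using that by (simp add: words_over_def)
  show "\<one>\<^bsub>?G\<^esub> \<in> carrier ?G"
    by (simp add: car one quotientI nil)
  fix U assume "U \<in> carrier ?G"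
  then obtain u where u: "u \<in> words_over X" "U = word_rel X R `` {u}"
    by (auto simp: car elim: quotientE)
  show "\<one>\<^bsub>?G\<^esub> \<otimes>\<^bsub>?G\<^esub> U = U"
    by (simp add: one u presented_group_mult nil)
  let ?v = "rev (map (\<lambda>(x, i). (x, \<not> i)) u)"
  have v: "?v \<in> words_over X"
    using u by (auto simp: words_over_def)
  have "word_rel X R `` {?v} \<otimes>\<^bsub>?G\<^esub> U = \<one>\<^bsub>?G\<^esub>"
    using word_rel_left_inverse[OF u(1), of R] u v
    by (simp add: one presented_group_mult equiv_class_eq[OF equiv_word_rel])
  then show "\<exists>V\<in>carrier ?G. V \<otimes>\<^bsub>?G\<^esub> U = \<one>\<^bsub>?G\<^esub>"
    using v by (auto simp: car intro!: bexI[of _ "word_rel X R `` {?v}"] quotientI)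
  fix V assume "V \<in> carrier ?G"
  then obtain v where v: "v \<in> words_over X" "V = word_rel X R `` {v}"
    by (auto simp: car elim: quotientE)
  show "U \<otimes>\<^bsub>?G\<^esub> V \<in> carrier ?G"
    by (simp add: u v presented_group_mult car app quotientI)
  fix W assume "W \<in> carrier ?G"
  then obtain w where w: "w \<in> words_over X" "W = word_rel X R `` {w}"
    by (auto simp: car elim: quotientE)
  show "U \<otimes>\<^bsub>?G\<^esub> V \<otimes>\<^bsub>?G\<^esub> W = U \<otimes>\<^bsub>?G\<^esub> (V \<otimes>\<^bsub>?G\<^esub> W)"
    by (simp add: u v w presented_group_mult app)
qed


section \<open>The inversion extension\<close>

datatype 'a ext_gen = Elem 'a | Ext

definition ext_generators :: "('a, 'm) monoid_scheme \<Rightarrow> 'a ext_gen set" where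
  "ext_generators A = Elem ` carrier A \<union> {Ext}"

text \<open>The first set is the multiplication table of \<open>A\<close>.\<close>

definition ext_relations ::
    "('a, 'm) monoid_scheme \<Rightarrow> 'a \<Rightarrow> ('a ext_gen word \<times> 'a ext_gen word) set" where
  "ext_relations A z =
    {([(Elem a, True), (Elem c, True)], [(Elem (a \<otimes>\<^bsub>A\<^esub> c), True)]) | a c.
        a \<in> carrier A \<and> c \<in> carrier A}
    \<union> {([(Ext, True), (Ext, True)], [(Elem z, True)])}
    \<union> {([(Ext, True), (Elem a, True), (Ext, False)], [(Elem (inv\<^bsub>A\<^esub> a), True)]) | a.
        a \<in> carrier A}"

definition inversion_extension ::
    "('a, 'm) monoid_scheme \<Rightarrow> 'a \<Rightarrow> 'a ext_gen word set monoid" where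
  "inversion_extension A z = presented_group (ext_generators A) (ext_relations A z)"


section \<open>Rate collections and random walks\<close>

definition rate_collection :: "('g, 'm) monoid_scheme \<Rightarrow> ('g \<Rightarrow> real) \<Rightarrow> bool" where
  "rate_collection G q \<longleftrightarrow> (\<forall>s\<in>carrier G. 0 \<le> q s)"

definition symmetric_rates :: "('g, 'm) monoid_scheme \<Rightarrow> ('g \<Rightarrow> real) \<Rightarrow> bool" where
  "symmetric_rates G q \<longleftrightarrow> (\<forall>s\<in>carrier G. q s = q (inv\<^bsub>G\<^esub> s))"

definition generating_rates :: "('g, 'm) monoid_scheme \<Rightarrow> ('g \<Rightarrow> real) \<Rightarrow> bool" where
  "generating_rates G q \<longleftrightarrow> generate G {s \<in> carrier G. q s > 0} = carrier G"

text \<open>\<open>N t\<close> is the number of rings of the clock in \<open>(0, t]\<close>.  The law of the increments is written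
  out because \<open>poisson_pmf\<close> excludes rate \<open>0\<close>, where the clock almost surely never rings (\<open>0 ^ 0 = 1\<close>).
  Subtraction of naturals does not truncate here, as paths are almost surely monotone.\<close>

locale poisson_clock = prob_space M for M :: "'w measure" +
  fixes rate :: real and N :: "real \<Rightarrow> 'w \<Rightarrow> nat"
  assumes count_measurable: "0 \<le> t \<Longrightarrow> N t \<in> M \<rightarrow>\<^sub>M count_space UNIV"
    and count_0: "AE \<omega> in M. N 0 \<omega> = 0"
    and count_mono: "AE \<omega> in M. mono_on {0..} (\<lambda>t. N t \<omega>)"
    and count_right_continuous: "AE \<omega> in M. \<forall>t\<ge>0. continuous (at_right t) (\<lambda>t. N t \<omega>)"
    and independent_increments:
      "mono \<tau> \<Longrightarrow> 0 \<le> \<tau> 0 \<Longrightarrow>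
        indep_vars (\<lambda>_. count_space UNIV) (\<lambda>i \<omega>. N (\<tau> (Suc i)) \<omega> - N (\<tau> i) \<omega>) {..<n::nat}"
    and poisson_increments:
      "0 \<le> u \<Longrightarrow> u \<le> t \<Longrightarrow>
        prob {\<omega> \<in> space M. N t \<omega> - N u \<omega> = k} =
          (rate * (t - u)) ^ k / fact k * exp (- (rate * (t - u)))"

text \<open>The clocks are independent as whole processes, i.e. as random functions on \<open>[0, \<infinity>)\<close>.
  The last two assumptions describe the motion: \<open>X\<close> does not move during \<open>(u, t]\<close> if no clock rings
  then, and it is multiplied by \<open>s\<close> on the right if the clock of \<open>s\<close> rings once and no other clock
  rings.  As almost surely the rings are locally finite and no two clocks ring simultaneously,
  subdividing \<open>(0, t]\<close> shows that this determines \<open>X\<close> up to a null set.\<close>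

locale clock_driven_walk = prob_space M for M :: "'w measure" +
  fixes G :: "('g, 'm) monoid_scheme" and q :: "'g \<Rightarrow> real"
    and N :: "'g \<Rightarrow> real \<Rightarrow> 'w \<Rightarrow> nat" and X :: "real \<Rightarrow> 'w \<Rightarrow> 'g"
  assumes clocks: "s \<in> carrier G \<Longrightarrow> poisson_clock M (q s) (N s)"
    and independent_clocks:
      "indep_vars (\<lambda>_. \<Pi>\<^sub>M t\<in>{0..}. count_space UNIV) (\<lambda>s \<omega>. \<lambda>t\<in>{0..}. N s t \<omega>) (carrier G)"
    and walk_measurable: "0 \<le> t \<Longrightarrow> X t \<in> M \<rightarrow>\<^sub>M count_space (carrier G)"
    and walk_0: "AE \<omega> in M. X 0 \<omega> = \<one>\<^bsub>G\<^esub>"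
    and walk_rest:
      "AE \<omega> in M. \<forall>u t. 0 \<le> u \<longrightarrow> u \<le> t \<longrightarrow> (\<forall>r\<in>carrier G. N r t \<omega> = N r u \<omega>)
        \<longrightarrow> X t \<omega> = X u \<omega>"
    and walk_ring:
      "AE \<omega> in M. \<forall>u t. \<forall>s\<in>carrier G. 0 \<le> u \<longrightarrow> u \<le> t \<longrightarrow> N s t \<omega> = Suc (N s u \<omega>)
        \<longrightarrow> (\<forall>r\<in>carrier G - {s}. N r t \<omega> = N r u \<omega>)
        \<longrightarrow> X t \<omega> = X u \<omega> \<otimes>\<^bsub>G\<^esub> s"

definition random_walk ::
    "('g, 'm) monoid_scheme \<Rightarrow> ('g \<Rightarrow> real) \<Rightarrow> 'w measure \<Rightarrow> (real \<Rightarrow> 'w \<Rightarrow> 'g) \<Rightarrow> bool" where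
  "random_walk G q M X \<longleftrightarrow> (\<exists>N. clock_driven_walk M G q N X)"

definition walk_prob :: "'w measure \<Rightarrow> (real \<Rightarrow> 'w \<Rightarrow> 'g) \<Rightarrow> real \<Rightarrow> 'g \<Rightarrow> real" where
  "walk_prob M X t g = measure M {\<omega> \<in> space M. X t \<omega> = g}"

definition lp_distance ::
    "('g, 'm) monoid_scheme \<Rightarrow> real \<Rightarrow> 'w measure \<Rightarrow> (real \<Rightarrow> 'w \<Rightarrow> 'g) \<Rightarrow> real \<Rightarrow> real" where
  "lp_distance G p M X t =
    (\<Sum>g\<in>carrier G. \<bar>walk_prob M X t g - 1 / real (order G)\<bar> powr p) powr (1 / p)"

text \<open>The law of the walk does not depend on the probability space that carries it.  The type
  argument only names the type of the sample points; results are meant to be polymorphic in it.\<close>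

definition rate_monotonic :: "'w itself \<Rightarrow> ('g, 'm) monoid_scheme \<Rightarrow> real \<Rightarrow> bool" where
  "rate_monotonic _ G p \<longleftrightarrow>
    (\<forall>q q'. rate_collection G q \<longrightarrow> symmetric_rates G q \<longrightarrow> generating_rates G q \<longrightarrow>
       rate_collection G q' \<longrightarrow> symmetric_rates G q' \<longrightarrow> generating_rates G q' \<longrightarrow>
       (\<forall>s\<in>carrier G. q s \<le> q' s) \<longrightarrow>
       (\<forall>(M :: 'w measure) X (M' :: 'w measure) X'.
          random_walk G q M X \<longrightarrow> random_walk G q' M' X' \<longrightarrow>
          (\<forall>t\<ge>0. lp_distance G p M' X' t \<le> lp_distance G p M X t)))"

end

theory Submission
  imports Defs "HOL-Library.Function_Algebras" "HOL-Real_Asymp.Real_Asymp"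
begin

text \<open>Let \<open>H\<close> be the image of \<open>A\<close> and split a function on the group into its even part (on \<open>H\<close>) and
  its odd part (on the other coset).  Raising the rate of one element \<open>s\<close> changes the law \<open>P = exp (q - |q|)\<close>
  in the direction \<open>Q - P\<close>, where \<open>Q\<close> is the law of the walk with one extra jump \<open>s\<close> at a uniform time.  By
  Young's inequality the \<open>2m\<close>-norm decreases as soon as \<open>Q\<close> is no further from uniform than \<open>P\<close>.  As the
  even part of \<open>q\<close> is central, both parts of \<open>Q\<close> can be computed: one is the average of two
  reflected or translated copies of the odd part of \<open>P\<close>, so that convexity applies, and the other is dominated in
  modulus, on the Fourier side, by the even part of \<open>P\<close>, whose transform is nonnegative.  Fourier
  analysis on \<open>A\<close> is replaced by Gram matrices: domination means that a block matrix built from the two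
  convolution kernels is positive semidefinite, and the Schur product theorem passes to even powers.

  That \<open>P\<close> is the law of the clock-driven walk follows from a lower bound: cut time into \<open>n\<close> intervals and
  keep only the paths with at most one ring in each of them.  In the limit the bounds add up to \<open>1\<close>, so
  they are equalities.\<close>

section \<open>Convolution on a finite group\<close>

text \<open>Write \<open>q = q0 + q1 b\<close> in the group algebra, with \<open>q0\<close> and
  \<open>q1\<close> living on \<open>H\<close>. Symmetry of the rates says that \<open>q0\<close> is
  inversion invariant, hence commutes with \<open>b\<close>, and that \<open>q1\<close> absorbs
  \<open>b \<otimes> b\<close>. So \<open>q1 b\<close> squares to \<open>w\<close>, the convolution
  of \<open>q1\<close> with its reflection, and powers of \<open>q\<close> expand as if
  \<open>q1 b\<close> were a commuting square root of \<open>w\<close>. An extra jump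
  \<open>c\<close> in \<open>H\<close> that is moved across \<open>b\<close> turns into its inverse.
  In one part of \<open>Q\<close> the two resulting terms have equal coefficients, by symmetry of
  the insertion time, which yields an average with weight 1/2; in the other they differ only in
  phase from terms whose sum is the even part of \<open>P\<close>. Two obstacles shape the rest.
  Series are compared term by term, so the even part of every power of \<open>q\<close> needs a
  nonnegative transform, not only the even part of \<open>P\<close>. Subtracting
  \<open>1 / real (order G)\<close> changes the transform on \<open>H\<close> at the trivial
  character alone, where nonnegativity means that the walk is in \<open>H\<close> with probability
  at least 1/2.\<close>

declare plus_fun_apply [simp del] zero_fun_apply [simp del]

text \<open>The value 0 outside the carrier makes the algebraic laws equations between functions,
  usable for rewriting.\<close>

definition conv :: "('g, 'm) monoid_scheme \<Rightarrow> ('g \<Rightarrow> real) \<Rightarrow> ('g \<Rightarrow> real) \<Rightarrow> 'g \<Rightarrow> real" where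
  "conv G f g = (\<lambda>x. if x \<in> carrier G then \<Sum>y\<in>carrier G. f y * g (inv\<^bsub>G\<^esub> y \<otimes>\<^bsub>G\<^esub> x) else 0)"

definition scale :: "real \<Rightarrow> ('g \<Rightarrow> real) \<Rightarrow> 'g \<Rightarrow> real" where
  "scale c f = (\<lambda>x. c * f x)"

definition point :: "'g \<Rightarrow> 'g \<Rightarrow> real" where
  "point c = (\<lambda>x. if x = c then 1 else 0)"

text \<open>The adjoint of a real function; for commutative \<open>G\<close> it is complex
  conjugation on the Fourier side.\<close>

definition reflect :: "('g, 'm) monoid_scheme \<Rightarrow> ('g \<Rightarrow> real) \<Rightarrow> 'g \<Rightarrow> real" where
  "reflect G f = (\<lambda>x. if x \<in> carrier G then f (inv\<^bsub>G\<^esub> x) else 0)"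

text \<open>The transform at the trivial character, hence multiplicative under convolution.\<close>

definition mass :: "('g, 'm) monoid_scheme \<Rightarrow> ('g \<Rightarrow> real) \<Rightarrow> real" where
  "mass G f = (\<Sum>x\<in>carrier G. f x)"

primrec conv_pow :: "('g, 'm) monoid_scheme \<Rightarrow> ('g \<Rightarrow> real) \<Rightarrow> nat \<Rightarrow> 'g \<Rightarrow> real" where
  "conv_pow G f 0 = point \<one>\<^bsub>G\<^esub>"
| "conv_pow G f (Suc n) = conv G (conv_pow G f n) f"

lemma scale_apply: "scale c f x = c * f x"
  by (simp add: scale_def)

lemma sum_fun_apply: "(\<Sum>i\<in>I. f i) x = (\<Sum>i\<in>I. f i x)" for f :: "'i \<Rightarrow> 'g \<Rightarrow> real"
  by (induction I rule: infinite_finite_induct) (simp_all add: plus_fun_apply zero_fun_apply)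

lemmas fun_apply = plus_fun_apply zero_fun_apply scale_apply sum_fun_apply

lemma scale_add: "scale c (f + g) = scale c f + scale c g"
  by (simp add: fun_eq_iff fun_apply algebra_simps)

lemma scale_scale: "scale c (scale d f) = scale (c * d) f"
  by (simp add: fun_eq_iff fun_apply)

lemma mass_zero [simp]: "mass G 0 = 0"
  by (simp add: mass_def zero_fun_apply)

lemma mass_add: "mass G (f + g) = mass G f + mass G g"
  by (simp add: mass_def fun_apply sum.distrib)

lemma mass_scale: "mass G (scale c f) = c * mass G f"
  by (simp add: mass_def fun_apply sum_distrib_left)

lemma conv_outside: "x \<notin> carrier G \<Longrightarrow> conv G f g x = 0"
  by (simp add: conv_def)

lemma conv_add_left: "conv G (f + g) h = conv G f h + conv G g h"
  by (auto simp: conv_def fun_apply fun_eq_iff sum.distrib algebra_simps)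

lemma conv_add_right: "conv G h (f + g) = conv G h f + conv G h g"
  by (auto simp: conv_def fun_apply fun_eq_iff sum.distrib algebra_simps)

lemma conv_scale_left: "conv G (scale c f) g = scale c (conv G f g)"
  by (auto simp: conv_def fun_apply fun_eq_iff sum_distrib_left algebra_simps intro!: sum.cong)

lemma conv_scale_right: "conv G f (scale c g) = scale c (conv G f g)"
  by (auto simp: conv_def fun_apply fun_eq_iff sum_distrib_left algebra_simps intro!: sum.cong)

lemma conv_zero_left [simp]: "conv G 0 f = 0"
  by (auto simp: conv_def fun_apply fun_eq_iff)

lemma conv_zero_right [simp]: "conv G f 0 = 0"
  by (auto simp: conv_def fun_apply fun_eq_iff)

lemma conv_sum_left: "conv G (\<Sum>i\<in>I. f i) g = (\<Sum>i\<in>I. conv G (f i) g)"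
  by (induction I rule: infinite_finite_induct) (simp_all add: conv_add_left)

lemma conv_sum_right: "conv G g (\<Sum>i\<in>I. f i) = (\<Sum>i\<in>I. conv G g (f i))"
  by (induction I rule: infinite_finite_induct) (simp_all add: conv_add_right)

lemma reflect_add: "reflect G (f + g) = reflect G f + reflect G g"
  by (auto simp: reflect_def fun_apply fun_eq_iff)

lemma reflect_scale: "reflect G (scale c f) = scale c (reflect G f)"
  by (auto simp: reflect_def fun_apply fun_eq_iff)

locale finite_group = group G for G :: "('g, 'm) monoid_scheme" (structure) +
  assumes finite_carrier [simp]: "finite (carrier G)"
begin

abbreviation conv_syntax (infixl \<open>\<star>\<close> 70) where "f \<star> g \<equiv> conv G f g"

lemma conv_eq: "x \<in> carrier G \<Longrightarrow> (f \<star> g) x = (\<Sum>y\<in>carrier G. f y * g (inv y \<otimes> x))"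
  by (simp add: conv_def)

lemma sum_translate_left:
  assumes "a \<in> carrier G"
  shows "(\<Sum>x\<in>carrier G. f (a \<otimes> x)) = (\<Sum>x\<in>carrier G. f x)"
  using assms
  by (intro sum.reindex_bij_witness[where j = "\<lambda>x. a \<otimes> x" and i = "\<lambda>x. inv a \<otimes> x"])
    (auto simp: m_assoc[symmetric])

lemma sum_translate_right:
  assumes "a \<in> carrier G"
  shows "(\<Sum>x\<in>carrier G. f (x \<otimes> a)) = (\<Sum>x\<in>carrier G. f x)"
  using assms
  by (intro sum.reindex_bij_witness[where j = "\<lambda>x. x \<otimes> a" and i = "\<lambda>x. x \<otimes> inv a"])
    (auto simp: m_assoc)

lemma sum_inverse: "(\<Sum>x\<in>carrier G. f (inv x)) = (\<Sum>x\<in>carrier G. f x)"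
  by (intro sum.reindex_bij_witness[where j = "\<lambda>x. inv x" and i = "\<lambda>x. inv x"]) auto

lemma conv_assoc: "f \<star> g \<star> h = f \<star> (g \<star> h)"
proof
  fix x
  show "(f \<star> g \<star> h) x = (f \<star> (g \<star> h)) x"
  proof (cases "x \<in> carrier G")
    case x: True
    have "(f \<star> g \<star> h) x = (\<Sum>y\<in>carrier G. \<Sum>w\<in>carrier G. f w * g (inv w \<otimes> y) * h (inv y \<otimes> x))"
      using x by (simp add: conv_eq sum_distrib_right)
    also have "\<dots> = (\<Sum>w\<in>carrier G. \<Sum>y\<in>carrier G. f w * g (inv w \<otimes> y) * h (inv y \<otimes> x))"
      by (rule sum.swap)
    also have "\<dots> = (\<Sum>w\<in>carrier G. f w * (\<Sum>v\<in>carrier G. g v * h (inv v \<otimes> (inv w \<otimes> x))))"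
    proof (rule sum.cong[OF HOL.refl])
      fix w assume w: "w \<in> carrier G"
      have "(\<Sum>y\<in>carrier G. f w * g (inv w \<otimes> y) * h (inv y \<otimes> x)) =
            (\<Sum>v\<in>carrier G. f w * g (inv w \<otimes> (w \<otimes> v)) * h (inv (w \<otimes> v) \<otimes> x))"
        using w by (subst sum_translate_left[of w, symmetric]) auto
      also have "\<dots> = (\<Sum>v\<in>carrier G. f w * (g v * h (inv v \<otimes> (inv w \<otimes> x))))"
        using w x by (intro sum.cong HOL.refl) (auto simp: inv_mult_group m_assoc[symmetric])
      finally show "(\<Sum>y\<in>carrier G. f w * g (inv w \<otimes> y) * h (inv y \<otimes> x)) =
            f w * (\<Sum>v\<in>carrier G. g v * h (inv v \<otimes> (inv w \<otimes> x)))"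
        by (simp add: sum_distrib_left)
    qed
    also have "\<dots> = (f \<star> (g \<star> h)) x"
      using x by (auto simp: conv_eq intro!: sum.cong)
    finally show ?thesis .
  qed (simp add: conv_def)
qed

lemma conv_point_right:
  assumes "c \<in> carrier G" "x \<in> carrier G"
  shows "(f \<star> point c) x = f (x \<otimes> inv c)"
proof -
  have "inv y \<otimes> x = c \<longleftrightarrow> y = x \<otimes> inv c" if "y \<in> carrier G" for y
    using assms that by (metis inv_closed inv_solve_left' inv_solve_right m_closed)
  then have "(f \<star> point c) x = (\<Sum>y\<in>carrier G. if y = x \<otimes> inv c then f y else 0)"
    using assms unfolding conv_eq[OF assms(2)] point_def by (intro sum.cong) auto
  then show ?thesis
    using assms by (simp add: sum.delta)
qed

lemma conv_point_left:
  assumes "c \<in> carrier G" "x \<in> carrier G"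
  shows "(point c \<star> f) x = f (inv c \<otimes> x)"
proof -
  have "(point c \<star> f) x = (\<Sum>y\<in>carrier G. if y = c then f (inv y \<otimes> x) else 0)"
    using assms unfolding conv_eq[OF assms(2)] point_def by (intro sum.cong) auto
  then show ?thesis
    using assms by (simp add: sum.delta)
qed

lemma conv_one_right: "(\<And>x. x \<notin> carrier G \<Longrightarrow> f x = 0) \<Longrightarrow> f \<star> point \<one> = f"
  by (auto simp: fun_eq_iff conv_outside conv_point_right) (metis conv_outside conv_point_right inv_one one_closed r_one)

lemma conv_one_left: "(\<And>x. x \<notin> carrier G \<Longrightarrow> f x = 0) \<Longrightarrow> point \<one> \<star> f = f"
  by (auto simp: fun_eq_iff) (metis conv_outside conv_point_left inv_one one_closed l_one)

lemma point_outside: "c \<in> carrier G \<Longrightarrow> x \<notin> carrier G \<Longrightarrow> point c x = 0"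
  by (auto simp: point_def)

lemma conv_pow_outside: "x \<notin> carrier G \<Longrightarrow> conv_pow G f n x = 0"
  by (cases n) (auto simp: point_outside conv_outside)

lemma mass_point: "c \<in> carrier G \<Longrightarrow> mass G (point c) = 1"
  by (simp add: mass_def point_def)

lemma mass_conv: "mass G (f \<star> g) = mass G f * mass G g"
proof -
  have "mass G (f \<star> g) = (\<Sum>x\<in>carrier G. \<Sum>y\<in>carrier G. f y * g (inv y \<otimes> x))"
    by (simp add: mass_def conv_eq)
  also have "\<dots> = (\<Sum>y\<in>carrier G. \<Sum>x\<in>carrier G. f y * g (inv y \<otimes> x))"
    by (rule sum.swap)
  also have "\<dots> = (\<Sum>y\<in>carrier G. f y * mass G g)"
    by (auto simp: sum_distrib_left[symmetric] mass_def sum_translate_left intro!: sum.cong)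
  finally show ?thesis
    by (simp add: mass_def sum_distrib_right)
qed

lemma mass_conv_pow: "mass G (conv_pow G f n) = mass G f ^ n"
  by (induction n) (auto simp: mass_point mass_conv)

lemma mass_reflect: "mass G (reflect G f) = mass G f"
  unfolding mass_def reflect_def using sum_inverse[of f] by (simp cong: sum.cong)

lemma reflect_conv: "reflect G (f \<star> g) = reflect G g \<star> reflect G f"
proof
  fix x
  show "reflect G (f \<star> g) x = (reflect G g \<star> reflect G f) x"
  proof (cases "x \<in> carrier G")
    case x: True
    have "reflect G (f \<star> g) x = (\<Sum>y\<in>carrier G. f y * g (inv y \<otimes> inv x))"
      using x by (simp add: reflect_def conv_eq)
    also have "\<dots> = (\<Sum>y\<in>carrier G. f (inv x \<otimes> y) * g (inv (inv x \<otimes> y) \<otimes> inv x))"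
      using x by (subst sum_translate_left[of "inv x", symmetric]) auto
    also have "\<dots> = (\<Sum>y\<in>carrier G. reflect G g y * reflect G f (inv y \<otimes> x))"
      using x by (intro sum.cong HOL.refl) (auto simp: reflect_def inv_mult_group m_assoc)
    finally show ?thesis
      using x by (simp add: conv_eq)
  qed (simp add: conv_def reflect_def)
qed

lemma reflect_reflect_conv [simp]: "reflect G (reflect G f) \<star> g = f \<star> g" "g \<star> reflect G (reflect G f) = g \<star> f"
  by (auto simp: conv_def fun_eq_iff reflect_def intro!: sum.cong)

lemma reflect_point: "c \<in> carrier G \<Longrightarrow> reflect G (point c) = point (inv c)"
  by (auto simp: reflect_def point_def fun_eq_iff)

end

section \<open>Domination of positive definite functions\<close>

text \<open>Gram kernels of finitely many real functions. Generating the cone from rank-one kernels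
  turns the Schur product theorem \<open>psd_mult\<close> into two inductions.\<close>

inductive psd :: "('p \<Rightarrow> 'p \<Rightarrow> real) \<Rightarrow> bool" where
  rank_one: "psd (\<lambda>x y. f x * f y)"
| add: "psd K \<Longrightarrow> psd L \<Longrightarrow> psd (\<lambda>x y. K x y + L x y)"

lemma psd_zero: "psd (\<lambda>x y. 0)"
  using rank_one[of "\<lambda>_. 0"] by simp

lemma psd_sum: "(\<And>i. i \<in> I \<Longrightarrow> psd (K i)) \<Longrightarrow> psd (\<lambda>x y. \<Sum>i\<in>I. K i x y)"
  by (induction I rule: infinite_finite_induct) (auto intro: psd_zero psd.add)

lemma psd_symmetric: "psd K \<Longrightarrow> K x y = K y x"
  by (induction rule: psd.induct) auto

lemma psd_mult_rank_one: "psd K \<Longrightarrow> psd (\<lambda>x y. f x * f y * K x y)"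
proof (induction rule: psd.induct)
  case (rank_one g)
  show ?case using psd.rank_one[of "\<lambda>x. f x * g x"] by (simp add: mult_ac)
next
  case (add K L)
  from psd.add[OF add.IH] show ?case by (simp add: algebra_simps)
qed

lemma psd_mult: "psd K \<Longrightarrow> psd L \<Longrightarrow> psd (\<lambda>x y. K x y * L x y)"
proof (induction rule: psd.induct)
  case (rank_one f)
  then show ?case by (rule psd_mult_rank_one)
next
  case (add K K')
  from psd.add[OF add.IH] show ?case using add.prems by (simp add: algebra_simps)
qed

lemma psd_scale: "psd K \<Longrightarrow> 0 \<le> c \<Longrightarrow> psd (\<lambda>x y. c * K x y)"
  using psd_mult_rank_one[of K "\<lambda>_. sqrt c"] by simp

lemma psd_power: "psd K \<Longrightarrow> psd (\<lambda>x y. K x y ^ n)"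
proof (induction n)
  case 0
  show ?case using rank_one[of "\<lambda>_. 1"] by simp
qed (auto intro: psd_mult)

lemma psd_quadratic_form: "psd K \<Longrightarrow> 0 \<le> (\<Sum>x\<in>S. \<Sum>y\<in>S. c x * c y * K x y)"
proof (induction rule: psd.induct)
  case (rank_one f)
  have "(\<Sum>x\<in>S. \<Sum>y\<in>S. c x * c y * (f x * f y)) = (\<Sum>x\<in>S. c x * f x) * (\<Sum>x\<in>S. c x * f x)"
    by (simp add: sum_product mult_ac)
  then show ?case by simp
next
  case (add K L)
  then show ?case by (simp add: algebra_simps sum.distrib)
qed

locale finite_comm_group = comm_group G + finite_group G for G (structure)
begin

lemma conv_comm: "f \<star> g = g \<star> f"
proof
  fix x
  show "(f \<star> g) x = (g \<star> f) x"
  proof (cases "x \<in> carrier G")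
    case x: True
    show ?thesis
      unfolding conv_eq[OF x] using x
      by (intro sum.reindex_bij_witness[where j = "\<lambda>y. inv y \<otimes> x" and i = "\<lambda>y. inv y \<otimes> x"])
        (auto simp: inv_mult m_ac mult.commute)
  qed (simp add: conv_def)
qed

lemma conv_left_comm: "f \<star> (g \<star> h) = g \<star> (f \<star> h)"
  by (metis conv_assoc conv_comm)

lemmas conv_ac = conv_assoc conv_comm conv_left_comm

lemma reflect_conv': "reflect G (f \<star> g) = reflect G f \<star> reflect G g"
  by (simp add: reflect_conv conv_comm)

lemmas conv_distribs = conv_add_left conv_add_right conv_scale_left conv_scale_right
  conv_sum_left conv_sum_right

text \<open>On the Fourier side, \<open>u \<lless> v\<close> says that the modulus of the transform of \<open>u\<close> is at most that of
  \<open>v\<close>, which is nonnegative.\<close>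

inductive dominated :: "('a \<Rightarrow> real) \<Rightarrow> ('a \<Rightarrow> real) \<Rightarrow> bool" (infix \<open>\<lless>\<close> 50) where
  base: "\<phi> \<star> reflect G \<phi> = \<psi> \<star> reflect G \<psi> \<Longrightarrow> \<phi> \<star> reflect G \<psi> \<lless> \<phi> \<star> reflect G \<phi>"
| add: "u \<lless> v \<Longrightarrow> u' \<lless> v' \<Longrightarrow> u + u' \<lless> v + v'"
| scale: "u \<lless> v \<Longrightarrow> 0 \<le> c \<Longrightarrow> scale c u \<lless> scale c v"

text \<open>Transforms multiply: two base pairs combine into the base pair of
  \<open>\<phi> \<star> \<alpha>\<close> and \<open>\<psi> \<star> \<beta>\<close>, where
  commutativity allows the factors to be regrouped.\<close>

lemma dominated_conv_base:
  assumes "u \<lless> v" "\<phi> \<star> reflect G \<phi> = \<psi> \<star> reflect G \<psi>"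
  shows "\<phi> \<star> reflect G \<psi> \<star> u \<lless> \<phi> \<star> reflect G \<phi> \<star> v"
  using assms(1)
proof induction
  case (base \<alpha> \<beta>)
  have "\<phi> \<star> reflect G \<psi> \<star> (\<alpha> \<star> reflect G \<beta>) = (\<phi> \<star> \<alpha>) \<star> reflect G (\<psi> \<star> \<beta>)"
    "\<phi> \<star> reflect G \<phi> \<star> (\<alpha> \<star> reflect G \<alpha>) = (\<phi> \<star> \<alpha>) \<star> reflect G (\<phi> \<star> \<alpha>)"
    by (simp_all add: reflect_conv' conv_ac)
  moreover have "(\<phi> \<star> \<alpha>) \<star> reflect G (\<phi> \<star> \<alpha>) = (\<psi> \<star> \<beta>) \<star> reflect G (\<psi> \<star> \<beta>)"
  proof -
    have "(\<phi> \<star> \<alpha>) \<star> reflect G (\<phi> \<star> \<alpha>) = (\<phi> \<star> reflect G \<phi>) \<star> (\<alpha> \<star> reflect G \<alpha>)"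
      by (simp add: reflect_conv' conv_ac)
    also have "\<dots> = (\<psi> \<star> reflect G \<psi>) \<star> (\<beta> \<star> reflect G \<beta>)"
      by (simp only: assms base)
    finally show ?thesis by (simp add: reflect_conv' conv_ac)
  qed
  ultimately show ?case using dominated.base by metis
qed (simp_all add: conv_distribs dominated.add dominated.scale)

lemma dominated_conv:
  assumes "u \<lless> v" "u' \<lless> v'"
  shows "u \<star> u' \<lless> v \<star> v'"
  using assms
proof induction
  case (base \<phi> \<psi>)
  then show ?case by (intro dominated_conv_base)
qed (simp_all add: conv_distribs dominated.add dominated.scale)

lemma dominated_zero: "0 \<lless> 0"
  using dominated.base[of 0 0] by simp

lemma dominated_sum: "(\<And>i. i \<in> I \<Longrightarrow> u i \<lless> v i) \<Longrightarrow> (\<Sum>i\<in>I. u i) \<lless> (\<Sum>i\<in>I. v i)"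
  by (induction I rule: infinite_finite_induct) (auto intro: dominated_zero dominated.add)

text \<open>For a base pair take the Gram matrix of the translates of \<phi> (index
  \<open>True\<close>) and of \<psi> (index \<open>False\<close>). The hypothesis of
  \<open>base\<close> says exactly that its two diagonal blocks coincide.\<close>

lemma dominated_imp_psd:
  assumes "u \<lless> v"
  shows "\<exists>K :: 'a \<times> bool \<Rightarrow> 'a \<times> bool \<Rightarrow> real. psd K \<and>
    (\<forall>x\<in>carrier G. \<forall>y\<in>carrier G. \<forall>i. K (x, i) (y, i) = v (x \<otimes> inv y) \<and>
      K (x, True) (y, False) = u (x \<otimes> inv y))"
  using assms
proof induction
  case (base \<phi> \<psi>)
  have *: "(\<alpha> \<star> reflect G \<beta>) (x \<otimes> inv y) = (\<Sum>s\<in>carrier G. \<alpha> (x \<otimes> s) * \<beta> (y \<otimes> s))"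
    if "x \<in> carrier G" "y \<in> carrier G" for x y \<alpha> \<beta>
  proof -
    have "(\<alpha> \<star> reflect G \<beta>) (x \<otimes> inv y) =
        (\<Sum>s\<in>carrier G. \<alpha> (x \<otimes> s) * reflect G \<beta> (inv (x \<otimes> s) \<otimes> (x \<otimes> inv y)))"
      using that by (simp add: conv_eq sum_translate_left[of x "\<lambda>s. \<alpha> s * reflect G \<beta> (inv s \<otimes> (x \<otimes> inv y))"])
    moreover have "inv (x \<otimes> s) \<otimes> (x \<otimes> inv y) = inv (y \<otimes> s)" if "s \<in> carrier G" for s
    proof -
      have "inv (x \<otimes> s) \<otimes> (x \<otimes> inv y) = inv s \<otimes> (inv x \<otimes> x) \<otimes> inv y"
        using that \<open>x \<in> _\<close> \<open>y \<in> _\<close> by (simp only: inv_mult_group m_assoc inv_closed m_closed)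
      then show ?thesis
        using that \<open>x \<in> _\<close> \<open>y \<in> _\<close> by (simp add: inv_mult_group)
    qed
    ultimately show ?thesis
      using that by (simp add: reflect_def)
  qed
  define K where "K = (\<lambda>p q. \<Sum>s\<in>carrier G. (if snd p then \<phi> else \<psi>) (fst p \<otimes> s) *
    (if snd q then \<phi> else \<psi>) (fst q \<otimes> s))"
  have "psd K"
    unfolding K_def by (intro psd_sum psd.rank_one)
  then show ?case
    using base *[of _ _ \<phi> \<phi>] *[of _ _ \<psi> \<psi>]
    by (intro exI[of _ K]) (auto simp: K_def * all_bool_eq)
next
  case (add u v u' v')
  then obtain K L :: "'a \<times> bool \<Rightarrow> 'a \<times> bool \<Rightarrow> real" where
    "psd K" "\<forall>x\<in>carrier G. \<forall>y\<in>carrier G. \<forall>i. K (x, i) (y, i) = v (x \<otimes> inv y) \<and>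
      K (x, True) (y, False) = u (x \<otimes> inv y)"
    "psd L" "\<forall>x\<in>carrier G. \<forall>y\<in>carrier G. \<forall>i. L (x, i) (y, i) = v' (x \<otimes> inv y) \<and>
      L (x, True) (y, False) = u' (x \<otimes> inv y)"
    by blast
  then show ?case
    by (intro exI[of _ "\<lambda>p q. K p q + L p q"]) (auto simp: fun_apply intro: psd.add)
next
  case (scale u v c)
  then obtain K :: "'a \<times> bool \<Rightarrow> 'a \<times> bool \<Rightarrow> real" where
    "psd K" "\<forall>x\<in>carrier G. \<forall>y\<in>carrier G. \<forall>i. K (x, i) (y, i) = v (x \<otimes> inv y) \<and>
      K (x, True) (y, False) = u (x \<otimes> inv y)"
    by blast
  with scale show ?case
    by (intro exI[of _ "\<lambda>p q. c * K p q"]) (auto simp: fun_apply intro: psd_scale)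
qed

text \<open>The entrywise \<open>n\<close>-th power of the block matrix is still positive
  semidefinite. Tested on the vector that is 1 on one block and -1 on the other, it leaves the
  difference of the two sums times \<open>2 * card (carrier G)\<close>.\<close>

lemma dominated_power_sum:
  assumes "u \<lless> v"
  shows "(\<Sum>x\<in>carrier G. u x ^ n) \<le> (\<Sum>x\<in>carrier G. v x ^ n)"
proof -
  obtain K :: "'a \<times> bool \<Rightarrow> 'a \<times> bool \<Rightarrow> real" where K: "psd K"
    and v: "\<And>x y i. x \<in> carrier G \<Longrightarrow> y \<in> carrier G \<Longrightarrow> K (x, i) (y, i) = v (x \<otimes> inv y)"
    and u: "\<And>x y i. x \<in> carrier G \<Longrightarrow> y \<in> carrier G \<Longrightarrow> K (x, True) (y, False) = u (x \<otimes> inv y)"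
    using dominated_imp_psd[OF assms] by blast
  have tr: "(\<Sum>x\<in>carrier G. \<Sum>y\<in>carrier G. f (x \<otimes> inv y)) = real (card (carrier G)) * (\<Sum>x\<in>carrier G. f x)"
    for f :: "'a \<Rightarrow> real"
    by (subst sum.swap) (simp add: sum_translate_right[of "inv _" f])
  have tr': "(\<Sum>x\<in>carrier G. \<Sum>y\<in>carrier G. f (y \<otimes> inv x)) = real (card (carrier G)) * (\<Sum>x\<in>carrier G. f x)"
    for f :: "'a \<Rightarrow> real"
    by (simp add: sum_translate_right[of "inv _" f])
  have split: "(\<Sum>p\<in>carrier G \<times> UNIV. h p) = (\<Sum>x\<in>carrier G. h (x, True)) + (\<Sum>x\<in>carrier G. h (x, False))"
    for h :: "'a \<times> bool \<Rightarrow> real"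
    by (subst sum.cartesian_product') (simp add: UNIV_bool sum.distrib add.commute)
  let ?c = "\<lambda>p :: 'a \<times> bool. if snd p then 1 else - 1 :: real"
  have "0 \<le> (\<Sum>p\<in>carrier G \<times> UNIV. \<Sum>q\<in>carrier G \<times> UNIV. ?c p * ?c q * K p q ^ n)"
    by (intro psd_quadratic_form psd_power K)
  also have "\<dots> = 2 * (\<Sum>x\<in>carrier G. \<Sum>y\<in>carrier G. v (x \<otimes> inv y) ^ n)
      - (\<Sum>x\<in>carrier G. \<Sum>y\<in>carrier G. u (x \<otimes> inv y) ^ n) - (\<Sum>x\<in>carrier G. \<Sum>y\<in>carrier G. u (y \<otimes> inv x) ^ n)"
    by (simp add: split u v psd_symmetric[OF K, of "(_, False)" "(_, True)"] sum.distrib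
      sum_negf sum_subtractf cong: sum.cong)
  also have "\<dots> = 2 * real (card (carrier G)) * ((\<Sum>x\<in>carrier G. v x ^ n) - (\<Sum>x\<in>carrier G. u x ^ n))"
    by (simp add: tr[of "\<lambda>x. v x ^ n"] tr[of "\<lambda>x. u x ^ n"] tr'[of "\<lambda>x. u x ^ n"] algebra_simps)
  finally have "0 \<le> 2 * real (card (carrier G)) * ((\<Sum>x\<in>carrier G. v x ^ n) - (\<Sum>x\<in>carrier G. u x ^ n))" .
  moreover have "0 < card (carrier G)"
    by (auto simp: card_gt_0_iff)
  ultimately show ?thesis
    by (auto simp: zero_le_mult_iff)
qed

text \<open>Characters have modulus 1 at \<open>c\<close>.\<close>

lemma dominated_point:
  assumes "c \<in> carrier G" shows "point c \<lless> point \<one>"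
proof -
  have [simp]: "reflect G (point \<one>) = point \<one>"
    by (simp add: reflect_point)
  have *: "point c \<star> point \<one> = point c" "point \<one> \<star> point \<one> = point \<one>"
    using assms by (auto intro: conv_one_right simp: point_outside)
  have "point c \<star> reflect G (point c) = point \<one>"
  proof
    fix x
    have "inv (inv c \<otimes> x) = c \<longleftrightarrow> x = \<one>" if "x \<in> carrier G"
      using assms that by (metis inv_closed inv_inv inv_one inv_solve_left one_closed r_one m_closed)
    then show "(point c \<star> reflect G (point c)) x = point \<one> x"
      using assms conv_point_left[OF assms, of x "reflect G (point c)"] by (cases "x \<in> carrier G")
        (simp_all add: conv_outside point_outside, simp add: reflect_def point_def)
  qed
  with dominated.base[of "point c" "point \<one>"] * show ?thesis by simp
qed

end

section \<open>Centred functions, limits of series and powers of a sum with a square root\<close>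

context finite_comm_group
begin

text \<open>A convolution idempotent: its transform is 1 at the trivial character and 0 elsewhere.
  Convolving with \<open>point \<one> + scale (- 1) uniform\<close> therefore erases the trivial
  character.\<close>

definition uniform :: "'a \<Rightarrow> real" where
  "uniform = (\<lambda>x. if x \<in> carrier G then 1 / real (card (carrier G)) else 0)"

lemma card_pos: "0 < card (carrier G)"
  by (auto simp: card_gt_0_iff)

lemma mass_uniform: "mass G uniform = 1"
  using card_pos by (auto simp: mass_def uniform_def)

lemma conv_uniform: "f \<star> uniform = scale (mass G f) uniform"
  by (auto simp: fun_eq_iff conv_def uniform_def fun_apply mass_def sum_distrib_right sum_divide_distrib)

lemma reflect_uniform: "reflect G uniform = uniform"
  by (auto simp: reflect_def uniform_def)

lemma dominated_uniform: "uniform \<lless> uniform"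
  using dominated.base[of uniform uniform]
  by (simp add: reflect_uniform conv_uniform mass_uniform) (simp add: scale_def)

lemma conv_centering:
  assumes "\<And>x. x \<notin> carrier G \<Longrightarrow> f x = 0"
  shows "f \<star> (point \<one> + scale (- 1) uniform) = f + scale (- mass G f) uniform"
  using assms by (simp add: conv_distribs conv_uniform conv_one_right scale_scale)

lemma dominated_centering: "point \<one> + scale (- 1) uniform \<lless> point \<one> + scale (- 1) uniform"
proof -
  let ?P = "point \<one> + scale (- 1) uniform"
  have "mass G ?P = 0"
    by (simp add: mass_add mass_scale mass_point mass_uniform)
  moreover have "?P \<star> ?P = ?P + scale (- mass G ?P) uniform"
    by (rule conv_centering) (auto simp: fun_apply uniform_def point_def)
  ultimately have "?P \<star> ?P = ?P"
    by (simp add: fun_eq_iff fun_apply)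
  moreover have "reflect G ?P = ?P"
    by (simp add: reflect_add reflect_scale reflect_uniform reflect_point)
  ultimately show ?thesis
    using dominated.base[of ?P ?P] by simp
qed

lemma dominated_outside: "u \<lless> v \<Longrightarrow> x \<notin> carrier G \<Longrightarrow> u x = 0 \<and> v x = 0"
  by (induction rule: dominated.induct) (auto simp: conv_outside fun_apply)

text \<open>Replaces the values at the trivial character by the common value \<open>c\<close> and
  leaves all other characters unchanged.\<close>

lemma dominated_centered:
  assumes "u \<lless> v" "0 \<le> c"
  shows "u + scale (- mass G u) uniform + scale c uniform \<lless> v + scale (- mass G v) uniform + scale c uniform"
proof -
  have "u \<star> (point \<one> + scale (- 1) uniform) = u + scale (- mass G u) uniform"
    "v \<star> (point \<one> + scale (- 1) uniform) = v + scale (- mass G v) uniform"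
    using dominated_outside[OF assms(1)] by (auto intro!: conv_centering)
  with dominated_conv[OF assms(1) dominated_centering] show ?thesis
    using assms(2) dominated_uniform by (auto intro: dominated.add dominated.scale)
qed

text \<open>Domination is used for partial sums; only the inequality of power sums is passed to the
  limit. The assumption \<open>beta\<close> is nonnegativity of \<open>V - \<beta>\<close> at the
  trivial character.\<close>

lemma dominated_series:
  assumes dom: "\<And>k. s k \<lless> v k" and mass: "\<And>k. mass G (s k) = mass G (v k)"
    and sums: "\<And>x. x \<in> carrier G \<Longrightarrow> (\<lambda>k. s k x) sums S x"
      "\<And>x. x \<in> carrier G \<Longrightarrow> (\<lambda>k. v k x) sums V x"
    and beta: "\<beta> * real (card (carrier G)) \<le> mass G V"
  shows "(\<Sum>x\<in>carrier G. (S x - \<beta>) ^ n) \<le> (\<Sum>x\<in>carrier G. (V x - \<beta>) ^ n)"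
proof (rule LIMSEQ_le)
  \<comment> \<open>The value of \<open>V - \<beta>\<close> at the trivial character. Using this
    limiting value for every partial sum keeps it nonnegative; a partial sum of \<open>v\<close>
    minus \<beta> could be negative there.\<close>
  define c where "c = mass G V - \<beta> * real (card (carrier G))"
  define shift where "shift = (\<lambda>u. u + scale (- mass G u) uniform + scale c uniform)"
  have lim: "(\<lambda>N. \<Sum>x\<in>carrier G. shift (\<Sum>k<N. f k) x ^ n) \<longlonglongrightarrow> (\<Sum>x\<in>carrier G. (F x - \<beta>) ^ n)"
    if f: "\<And>x. x \<in> carrier G \<Longrightarrow> (\<lambda>k. f k x) sums F x" and m: "mass G F = mass G V" for f F
  proof (intro tendsto_sum tendsto_power)
    fix x assume x: "x \<in> carrier G"
    have l: "(\<lambda>N. (\<Sum>k<N. f k) x) \<longlonglongrightarrow> F x" if "x \<in> carrier G" for x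
      using f[OF that] by (simp add: sums_def fun_apply)
    then have "(\<lambda>N. mass G (\<Sum>k<N. f k)) \<longlonglongrightarrow> mass G F"
      unfolding mass_def by (intro tendsto_sum) auto
    then have "(\<lambda>N. shift (\<Sum>k<N. f k) x) \<longlonglongrightarrow>
        F x + - mass G F * uniform x + c * uniform x"
      unfolding shift_def fun_apply by (intro tendsto_intros) (use l[OF x] in \<open>simp add: fun_apply\<close>)
    also have "F x + - mass G F * uniform x + c * uniform x = F x - \<beta>"
      using x card_pos by (auto simp: m c_def uniform_def diff_divide_distrib)
    finally show "(\<lambda>N. shift (\<Sum>k<N. f k) x) \<longlonglongrightarrow> F x - \<beta>" .
  qed
  have "(\<lambda>k. mass G (s k)) sums mass G S" "(\<lambda>k. mass G (v k)) sums mass G V"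
    unfolding mass_def by (intro sums_sum sums; assumption)+
  then have "mass G S = mass G V"
    using mass sums_unique2 by auto
  then show "(\<lambda>N. \<Sum>x\<in>carrier G. shift (\<Sum>k<N. s k) x ^ n) \<longlonglongrightarrow> (\<Sum>x\<in>carrier G. (S x - \<beta>) ^ n)"
    by (intro lim sums)
  show "(\<lambda>N. \<Sum>x\<in>carrier G. shift (\<Sum>k<N. v k) x ^ n) \<longlonglongrightarrow> (\<Sum>x\<in>carrier G. (V x - \<beta>) ^ n)"
    by (intro lim sums) auto
  have "0 \<le> c" using beta by (simp add: c_def)
  then have "shift (\<Sum>k<N. s k) \<lless> shift (\<Sum>k<N. v k)" for N
    unfolding shift_def by (intro dominated_centered dominated_sum dom)
  then show "\<exists>N. \<forall>i\<ge>N. (\<Sum>x\<in>carrier G. shift (\<Sum>k<i. s k) x ^ n)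
      \<le> (\<Sum>x\<in>carrier G. shift (\<Sum>k<i. v k) x ^ n)"
    using dominated_power_sum by blast
qed

text \<open>Formally, \<open>ev p w n\<close> and \<open>od p w n\<close> are the coefficients in \<open>(p + \<surd>w) ^ n = ev p w n + od p w n \<surd>w\<close>.\<close>

fun ev od :: "('a \<Rightarrow> real) \<Rightarrow> ('a \<Rightarrow> real) \<Rightarrow> nat \<Rightarrow> 'a \<Rightarrow> real" where
  "ev p w 0 = point \<one>"
| "od p w 0 = 0"
| "ev p w (Suc n) = ev p w n \<star> p + od p w n \<star> w"
| "od p w (Suc n) = ev p w n + od p w n \<star> p"

lemma ev_outside: "x \<notin> carrier G \<Longrightarrow> ev p w n x = 0"
  by (cases n) (auto simp: point_outside fun_apply conv_outside)

lemma od_outside: "x \<notin> carrier G \<Longrightarrow> od p w n x = 0"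
  by (cases n) (auto simp: ev_outside fun_apply conv_outside)

lemma ev_one [simp]: "ev p w n \<star> point \<one> = ev p w n" "point \<one> \<star> ev p w n = ev p w n"
  by (auto intro!: conv_one_left conv_one_right ev_outside)

lemma od_one [simp]: "od p w n \<star> point \<one> = od p w n" "point \<one> \<star> od p w n = od p w n"
  by (auto intro!: conv_one_left conv_one_right od_outside)

text \<open>Compare coefficients in the product of the \<open>j\<close>-th and the
  \<open>k\<close>-th power of \<open>p + \<surd>w\<close>.\<close>

lemma ev_od_add:
  "ev p w (j + k) = ev p w j \<star> ev p w k + w \<star> (od p w j \<star> od p w k)"
  "od p w (j + k) = ev p w j \<star> od p w k + od p w j \<star> ev p w k"
  by (induction k) (simp_all add: conv_distribs conv_ac add_ac)

lemma reflect_ev_od: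
  assumes "reflect G p = p" "reflect G w = w"
  shows "reflect G (ev p w n) = ev p w n" "reflect G (od p w n) = od p w n"
proof (induction n)
  case 0
  {
    case 1
    show ?case by (simp add: reflect_point)
  next
    case 2
    show ?case by (auto simp: reflect_def fun_apply fun_eq_iff)
  }
qed (simp_all add: assms reflect_add reflect_conv')

lemma dominated_ev_od:
  assumes "p \<lless> p" "w \<lless> w"
  shows "ev p w n \<lless> ev p w n" "od p w n \<lless> od p w n"
proof (induction n)
  case 0
  {
    case 1
    show ?case by (simp add: dominated_point)
  next
    case 2
    show ?case by (simp add: dominated_zero)
  }
qed (auto simp: assms intro!: dominated.add dominated_conv)

text \<open>An extra jump can be inserted after any \<open>j\<close> of \<open>n\<close> ordinary
  jumps; these sums collect the coefficients before and after it.\<close>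

definition cauchy :: "(nat \<Rightarrow> 'a \<Rightarrow> real) \<Rightarrow> (nat \<Rightarrow> 'a \<Rightarrow> real) \<Rightarrow> nat \<Rightarrow> 'a \<Rightarrow> real" where
  "cauchy f g n = (\<Sum>j\<le>n. f j \<star> g (n - j))"

lemma cauchy_Suc: "cauchy f g (Suc n) = cauchy f (\<lambda>k. g (Suc k)) n + f (Suc n) \<star> g 0"
  unfolding cauchy_def by (auto simp: Suc_diff_le intro!: arg_cong2[where f = "(+)"] sum.cong)

lemma cauchy_comm: "cauchy f g n = cauchy g f n"
  unfolding cauchy_def
  by (rule sum.reindex_bij_witness[where i = "\<lambda>j. n - j" and j = "\<lambda>j. n - j"]) (auto simp: conv_comm)

lemma cauchy_ev_Suc:
  "cauchy f (ev p w) (Suc n) = cauchy f (ev p w) n \<star> p + cauchy f (od p w) n \<star> w + f (Suc n) \<star> point \<one>"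
  by (simp add: cauchy_Suc) (simp add: cauchy_def conv_distribs sum.distrib conv_ac)

lemma cauchy_od_Suc: "cauchy f (od p w) (Suc n) = cauchy f (ev p w) n + cauchy f (od p w) n \<star> p"
  by (simp add: cauchy_Suc) (simp add: cauchy_def conv_distribs sum.distrib conv_ac)

lemma cauchy_0:
  "cauchy (ev p w) (ev p w) 0 = ev p w 0" "cauchy (od p w) (od p w) 0 = 0"
  "cauchy (ev p w) (od p w) 0 = 0" "cauchy (od p w) (ev p w) 0 = 0"
  by (simp_all add: cauchy_def ev_one[of _ _ 0, simplified])

lemma cauchy_ev_ev_Suc: "cauchy (ev p w) (ev p w) (Suc n) =
    cauchy (ev p w) (ev p w) n \<star> p + cauchy (ev p w) (od p w) n \<star> w + ev p w (Suc n)"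
  by (simp only: cauchy_ev_Suc ev_one)

lemma cauchy_od_ev_Suc: "cauchy (od p w) (ev p w) (Suc n) =
    cauchy (od p w) (ev p w) n \<star> p + cauchy (od p w) (od p w) n \<star> w + od p w (Suc n)"
  by (simp only: cauchy_ev_Suc od_one)

text \<open>By \<open>ev_od_add\<close>, each of the \<open>Suc n\<close> places of insertion
  contributes \<open>ev p w n\<close>.\<close>

lemma cauchy_ev_ev: "cauchy (ev p w) (ev p w) n + w \<star> cauchy (od p w) (od p w) n = scale (real (Suc n)) (ev p w n)"
proof -
  have "cauchy (ev p w) (ev p w) n + w \<star> cauchy (od p w) (od p w) n =
      (\<Sum>j\<le>n. ev p w (j + (n - j)))"
    unfolding ev_od_add cauchy_def conv_sum_right sum.distrib ..
  also have "\<dots> = (\<Sum>j\<le>n. ev p w n)"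
    by (intro sum.cong) auto
  finally show ?thesis by (simp add: fun_eq_iff fun_apply)
qed

text \<open>The two mixed sums add up to \<open>Suc n\<close> copies of \<open>od p w n\<close>, and
  commutativity makes them equal. This is the origin of the averages with weight 1/2.\<close>

lemma cauchy_ev_od: "cauchy (ev p w) (od p w) n = scale (real (Suc n) / 2) (od p w n)"
proof -
  have "cauchy (ev p w) (od p w) n + cauchy (od p w) (ev p w) n = (\<Sum>j\<le>n. od p w (j + (n - j)))"
    unfolding ev_od_add cauchy_def conv_sum_right sum.distrib ..
  also have "\<dots> = (\<Sum>j\<le>n. od p w n)"
    by (intro sum.cong) auto
  finally have "cauchy (ev p w) (od p w) n x + cauchy (ev p w) (od p w) n x = real (Suc n) * od p w n x" for x
    by (simp add: cauchy_comm[of "od p w"] fun_eq_iff fun_apply)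
  then show ?thesis
    by (simp add: fun_eq_iff fun_apply field_simps)
qed

text \<open>Translations, and \<omega> in place of \<open>w\<close>, do not increase moduli; without
  them the left side is that of \<open>cauchy_ev_ev\<close>.\<close>

lemma dominated_cauchy:
  assumes "p \<lless> p" "\<omega> \<lless> w" "w \<lless> w" "c \<in> carrier G" "c' \<in> carrier G"
  shows "cauchy (ev p w) (ev p w) n \<star> point c + \<omega> \<star> cauchy (od p w) (od p w) n \<star> point c' \<lless>
    scale (real (Suc n)) (ev p w n)"
proof -
  have "cauchy (ev p w) (ev p w) n \<lless> cauchy (ev p w) (ev p w) n"
    "cauchy (od p w) (od p w) n \<lless> cauchy (od p w) (od p w) n"
    unfolding cauchy_def by (intro dominated_sum dominated_conv dominated_ev_od assms)+
  then have "cauchy (ev p w) (ev p w) n \<star> point c + \<omega> \<star> cauchy (od p w) (od p w) n \<star> point c' \<lless>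
      cauchy (ev p w) (ev p w) n \<star> point \<one> + w \<star> cauchy (od p w) (od p w) n \<star> point \<one>"
    by (intro dominated.add dominated_conv dominated_point assms)
  also have "\<dots> = cauchy (ev p w) (ev p w) n + w \<star> cauchy (od p w) (od p w) n"
    by (intro arg_cong2[where f = "(+)"] conv_one_right)
      (auto simp: cauchy_def fun_apply conv_outside)
  finally show ?thesis
    by (simp only: cauchy_ev_ev)
qed

text \<open>\<open>dominated_series\<close> also asks for equality at the trivial character, where
  translations have no effect.\<close>

lemma mass_cauchy:
  assumes "mass G \<omega> = mass G w" "c \<in> carrier G" "c' \<in> carrier G"
  shows "mass G (cauchy (ev p w) (ev p w) n \<star> point c + \<omega> \<star> cauchy (od p w) (od p w) n \<star> point c') =
    mass G (scale (real (Suc n)) (ev p w n))"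
  unfolding cauchy_ev_ev[symmetric] by (simp add: mass_add mass_conv mass_point assms)

text \<open>By symmetry, \<open>q + scale (mass G q) (point \<one>)\<close> is the sum over
  \<open>a\<close> of \<open>q a / 2\<close> times \<open>h a \<star> reflect G (h a)\<close> with
  \<open>h a = point \<one> + point a\<close>. On the Fourier side this is
  \<open>1 + cos \<ge> 0\<close>.\<close>

lemma dominated_self_lazy:
  assumes sym: "reflect G q = q" and nonneg: "\<And>x. 0 \<le> q x" and k: "mass G q \<le> k"
  shows "q + scale k (point \<one>) \<lless> q + scale k (point \<one>)"
proof -
  define h where "h a = point \<one> + point a" for a :: 'a
  have out: "x \<notin> carrier G \<Longrightarrow> q x = 0" for x
    using sym by (metis reflect_def)
  have [simp]: "point \<one> \<star> point \<one> = point \<one>"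
    by (auto intro!: conv_one_left simp: point_outside)
  have hh: "h a \<star> reflect G (h a) = scale 2 (point \<one>) + point a + point (inv a)" if "a \<in> carrier G" for a
  proof -
    have "point a \<star> point (inv a) = point \<one>"
    proof
      fix x show "(point a \<star> point (inv a)) x = point \<one> x"
        using that by (cases "x \<in> carrier G")
          (simp_all add: conv_outside point_outside conv_point_right, auto simp: point_def inv_solve_right)
    qed
    moreover have "point a \<star> point \<one> = point a" "point \<one> \<star> point (inv a) = point (inv a)"
      using that by (auto intro!: conv_one_left conv_one_right simp: point_outside)
    ultimately have "h a \<star> reflect G (h a) = point \<one> + point (inv a) + (point a + point \<one>)"
      using that by (simp add: h_def reflect_add reflect_point conv_distribs)
    then show ?thesis
      by (auto simp: fun_eq_iff fun_apply)
  qed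
  have "(\<Sum>a\<in>carrier G. scale (q a / 2) (h a \<star> reflect G (h a))) x = (mass G q * point \<one> x + q x)" for x
  proof -
    have "(\<Sum>a\<in>carrier G. scale (q a / 2) (h a \<star> reflect G (h a))) x =
        (\<Sum>a\<in>carrier G. q a * point \<one> x + q a / 2 * point a x + q a / 2 * point (inv a) x)"
      by (auto simp: fun_apply hh field_simps intro!: sum.cong)
    also have "\<dots> = mass G q * point \<one> x + (\<Sum>a\<in>carrier G. q a / 2 * point a x)
        + (\<Sum>a\<in>carrier G. q (inv a) / 2 * point (inv (inv a)) x)"
      using sum_inverse[of "\<lambda>a. q a / 2 * point (inv a) x"]
      by (simp add: sum.distrib mass_def sum_distrib_right)
    also have "(\<Sum>a\<in>carrier G. q (inv a) / 2 * point (inv (inv a)) x) = (\<Sum>a\<in>carrier G. q a / 2 * point a x)"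
    proof (intro sum.cong HOL.refl)
      fix a assume "a \<in> carrier G"
      moreover from this have "q (inv a) = q a"
        using fun_cong[OF sym, of a] by (simp add: reflect_def)
      ultimately show "q (inv a) / 2 * point (inv (inv a)) x = q a / 2 * point a x" by simp
    qed
    also have "(\<Sum>a\<in>carrier G. q a / 2 * point a x) = q x / 2"
    proof -
      have "(\<Sum>a\<in>carrier G. q a / 2 * point a x) = (\<Sum>a\<in>carrier G. if x = a then q a / 2 else 0)"
        by (intro sum.cong) (auto simp: point_def)
      then show ?thesis using out by (simp add: sum.delta')
    qed
    finally show ?thesis by simp
  qed
  then have "q + scale k (point \<one>) =
      (\<Sum>a\<in>carrier G. scale (q a / 2) (h a \<star> reflect G (h a))) + scale (k - mass G q) (point \<one>)"
    by (simp only: fun_eq_iff plus_fun_apply) (simp add: scale_apply algebra_simps)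
  moreover have "\<dots> \<lless> \<dots>"
    using k nonneg
    by (intro dominated.add dominated_sum dominated.scale dominated_point) (auto intro!: dominated.base)
  ultimately show ?thesis by simp
qed

end

section \<open>The convolution exponential and its derivative\<close>

text \<open>The derivative of the \<open>n\<close>-th power of \<open>q\<close> in direction
  \<open>d\<close>, by the product rule. The order of the factors matters, as \<open>d\<close> need
  not commute with \<open>q\<close>.\<close>

primrec conv_deriv :: "('g, 'm) monoid_scheme \<Rightarrow> ('g \<Rightarrow> real) \<Rightarrow> ('g \<Rightarrow> real) \<Rightarrow> nat \<Rightarrow> 'g \<Rightarrow> real" where
  "conv_deriv G q d 0 = 0"
| "conv_deriv G q d (Suc n) = conv G (conv_deriv G q d n) q + conv G (conv_pow G q n) d"

definition conv_exp :: "('g, 'm) monoid_scheme \<Rightarrow> ('g \<Rightarrow> real) \<Rightarrow> 'g \<Rightarrow> real" where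
  "conv_exp G q = (\<lambda>x. \<Sum>n. conv_pow G q n x / fact n)"

definition conv_exp_deriv :: "('g, 'm) monoid_scheme \<Rightarrow> ('g \<Rightarrow> real) \<Rightarrow> ('g \<Rightarrow> real) \<Rightarrow> 'g \<Rightarrow> real" where
  "conv_exp_deriv G q d = (\<lambda>x. \<Sum>n. conv_deriv G q d n x / fact n)"

text \<open>For nonnegative \<open>q\<close> this is the law at time 1: the number of jumps is
  Poisson with mean \<open>mass G q\<close>. Other times are absorbed into the rates.\<close>

definition walk_law :: "('g, 'm) monoid_scheme \<Rightarrow> ('g \<Rightarrow> real) \<Rightarrow> 'g \<Rightarrow> real" where
  "walk_law G q x = exp (- mass G q) * conv_exp G q x"

abbreviation norm1 :: "('g, 'm) monoid_scheme \<Rightarrow> ('g \<Rightarrow> real) \<Rightarrow> real" where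
  "norm1 G f \<equiv> mass G (\<lambda>x. \<bar>f x\<bar>)"

lemma conv_cong:
  assumes "group G" "\<And>x. x \<in> carrier G \<Longrightarrow> f x = f' x" "\<And>x. x \<in> carrier G \<Longrightarrow> g x = g' x"
  shows "conv G f g = conv G f' g'"
proof -
  interpret group G by fact
  show ?thesis
    using assms(2,3) by (auto simp: conv_def fun_eq_iff intro!: sum.cong)
qed

context finite_group
begin

lemma norm1_nonneg: "0 \<le> norm1 G f"
  by (simp add: mass_def sum_nonneg)

lemma norm1_add: "norm1 G (f + g) \<le> norm1 G f + norm1 G g"
  unfolding mass_def sum.distrib[symmetric] by (intro sum_mono) (simp add: fun_apply)

lemma norm1_scale: "norm1 G (scale c f) = \<bar>c\<bar> * norm1 G f"
  by (simp add: mass_def sum_distrib_left fun_apply abs_mult)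

lemma norm1_conv: "norm1 G (f \<star> g) \<le> norm1 G f * norm1 G g"
proof -
  have "norm1 G (f \<star> g) \<le> mass G ((\<lambda>x. \<bar>f x\<bar>) \<star> (\<lambda>x. \<bar>g x\<bar>))"
    unfolding mass_def
    by (intro sum_mono) (auto simp: conv_eq abs_mult intro!: order.trans[OF sum_abs])
  then show ?thesis
    by (simp add: mass_conv)
qed

lemma abs_le_norm1: "x \<in> carrier G \<Longrightarrow> \<bar>f x\<bar> \<le> norm1 G f"
  unfolding mass_def by (rule member_le_sum) auto

lemma norm1_conv_pow: "norm1 G q \<le> C \<Longrightarrow> norm1 G (conv_pow G q n) \<le> C ^ n"
proof (induction n)
  case 0
  have "(\<lambda>x. \<bar>point \<one> x\<bar>) = point \<one>" by (auto simp: point_def)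
  then show ?case by (simp add: mass_point)
next
  case (Suc n)
  have "norm1 G (conv_pow G q n \<star> q) \<le> C ^ n * C"
    using Suc norm1_nonneg[of q]
    by (intro order.trans[OF norm1_conv] mult_mono) (auto simp: norm1_nonneg intro!: zero_le_power order.trans[OF norm1_nonneg Suc.prems])
  then show ?case by (simp add: mult.commute)
qed

lemma norm1_conv_deriv:
  assumes "norm1 G q \<le> C" "norm1 G d \<le> C"
  shows "norm1 G (conv_deriv G q d n) \<le> real n * C ^ n"
proof (induction n)
  case 0
  then show ?case by (simp add: fun_apply mass_def)
next
  case (Suc n)
  have C: "0 \<le> C" using assms norm1_nonneg order.trans by blast
  have "norm1 G (conv_deriv G q d (Suc n)) \<le>
      norm1 G (conv_deriv G q d n) * norm1 G q + norm1 G (conv_pow G q n) * norm1 G d"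
    by (simp add: order.trans[OF norm1_add] add_mono norm1_conv)
  also have "\<dots> \<le> (real n * C ^ n) * C + C ^ n * C"
    using C assms by (intro add_mono mult_mono Suc norm1_conv_pow) (auto simp: norm1_nonneg)
  finally show ?case by (simp add: algebra_simps)
qed

lemma summable_nat_mult_power_fact: "summable (\<lambda>n. real n * C ^ n / fact n)" for C :: real
proof -
  have "summable (\<lambda>n. real (Suc n) * C ^ Suc n / fact (Suc n))"
  proof -
    have "(\<lambda>n. real (Suc n) * C ^ Suc n / fact (Suc n)) = (\<lambda>n. C * (inverse (fact n) * C ^ n))"
    proof
      fix n
      have "real (Suc n) * C ^ Suc n / fact (Suc n) = (real (Suc n) * (C * C ^ n)) / (real (Suc n) * fact n)"
        by simp
      also have "\<dots> = C * C ^ n / fact n"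
        by (rule mult_divide_mult_cancel_left) simp
      finally show "real (Suc n) * C ^ Suc n / fact (Suc n) = C * (inverse (fact n) * C ^ n)"
        by (simp add: field_simps)
    qed
    then show ?thesis by (simp only: summable_mult summable_exp)
  qed
  then show ?thesis by (rule summable_Suc_iff[THEN iffD1])
qed

lemma summable_conv_exp: "x \<in> carrier G \<Longrightarrow> summable (\<lambda>n. conv_pow G q n x / fact n)"
proof (rule summable_comparison_test')
  show "summable (\<lambda>n. inverse (fact n) * norm1 G q ^ n)" by (rule summable_exp)
  fix n assume "x \<in> carrier G"
  then have "\<bar>conv_pow G q n x\<bar> \<le> norm1 G q ^ n"
    using abs_le_norm1 norm1_conv_pow order.trans by blast
  then show "norm (conv_pow G q n x / fact n) \<le> inverse (fact n) * norm1 G q ^ n"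
    by (simp add: field_simps)
qed

lemma summable_conv_exp_deriv: "x \<in> carrier G \<Longrightarrow> summable (\<lambda>n. conv_deriv G q d n x / fact n)"
proof (rule summable_comparison_test')
  let ?C = "max (norm1 G q) (norm1 G d)"
  show "summable (\<lambda>n. real n * ?C ^ n / fact n)" by (rule summable_nat_mult_power_fact)
  fix n assume "x \<in> carrier G"
  then have "\<bar>conv_deriv G q d n x\<bar> \<le> real n * ?C ^ n"
    using abs_le_norm1 norm1_conv_deriv[of q ?C d n] order.trans by (meson max.cobounded1 max.cobounded2)
  then show "norm (conv_deriv G q d n x / fact n) \<le> real n * ?C ^ n / fact n"
    by (simp add: divide_right_mono)
qed

lemma DERIV_conv_pow:
  "((\<lambda>\<theta>. conv_pow G (q + scale \<theta> d) n x) has_real_derivative conv_deriv G (q + scale \<theta> d) d n x) (at \<theta>)"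
proof (induction n arbitrary: x)
  case (Suc n)
  show ?case
  proof (cases "x \<in> carrier G")
    case True
    have "((\<lambda>\<theta>. conv_pow G (q + scale \<theta> d) n y * (q + scale \<theta> d) z) has_real_derivative
        conv_deriv G (q + scale \<theta> d) d n y * (q + scale \<theta> d) z + conv_pow G (q + scale \<theta> d) n y * d z) (at \<theta>)"
      for y z
      by (rule DERIV_cong[OF DERIV_mult[OF Suc]]) (auto intro!: derivative_eq_intros
          simp: plus_fun_apply[of q _ z] scale_apply[of _ d z] mult.commute)
    then show ?thesis
      unfolding conv_pow.simps conv_deriv.simps plus_fun_apply[of "conv G _ _"] conv_eq[OF True] sum.distrib[symmetric]
      by (intro DERIV_sum)
  qed (simp add: conv_outside fun_apply)
qed (simp add: fun_apply)

text \<open>Termwise differentiation needs Lipschitz constants for the terms, uniform near \<theta>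
  and summable; \<open>norm1_conv_deriv\<close> and the mean value inequality provide them.\<close>

lemma DERIV_conv_exp:
  assumes x: "x \<in> carrier G"
  shows "((\<lambda>\<theta>. conv_exp G (q + scale \<theta> d) x) has_real_derivative
    conv_exp_deriv G (q + scale \<theta> d) d x) (at \<theta>)"
  unfolding conv_exp_def conv_exp_deriv_def
proof (rule DERIV_series')
  \<comment> \<open>Chosen to bound the norm of \<open>q + scale \<eta> d\<close> for every \<eta>
    within distance 1 of \<theta>, and the norm of \<open>d\<close>.\<close>
  define C where "C = norm1 G q + (\<bar>\<theta>\<bar> + 1) * norm1 G d + norm1 G d"
  show "((\<lambda>\<theta>. conv_pow G (q + scale \<theta> d) n x / fact n) has_real_derivative
      conv_deriv G (q + scale \<theta> d) d n x / fact n) (at \<theta>)" for n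
    by (intro DERIV_cdivide DERIV_conv_pow)
  show "summable (\<lambda>n. conv_pow G (q + scale \<eta> d) n x / fact n)" for \<eta>
    using x by (rule summable_conv_exp)
  show "summable (\<lambda>n. conv_deriv G (q + scale \<theta> d) d n x / fact n)"
    using x by (rule summable_conv_exp_deriv)
  show "\<theta> \<in> {\<theta> - 1<..<\<theta> + 1}" by simp
  show "summable (\<lambda>n. real n * C ^ n / fact n)" by (rule summable_nat_mult_power_fact)
  fix n \<alpha> \<beta> assume ab: "\<alpha> \<in> {\<theta> - 1<..<\<theta> + 1}" "\<beta> \<in> {\<theta> - 1<..<\<theta> + 1}"
  have bound: "\<bar>conv_deriv G (q + scale \<eta> d) d n x\<bar> \<le> real n * C ^ n" if "\<eta> \<in> {\<theta> - 1<..<\<theta> + 1}" for \<eta>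
  proof -
    have "norm1 G (q + scale \<eta> d) \<le> norm1 G q + \<bar>\<eta>\<bar> * norm1 G d"
      using norm1_add[of q "scale \<eta> d"] by (simp add: norm1_scale)
    also have "\<dots> \<le> norm1 G q + (\<bar>\<theta>\<bar> + 1) * norm1 G d"
      using that by (intro add_left_mono mult_right_mono norm1_nonneg) auto
    also have "\<dots> \<le> C" using norm1_nonneg[of d] by (simp add: C_def)
    finally have "norm1 G (q + scale \<eta> d) \<le> C" .
    moreover have "norm1 G d \<le> C"
      using norm1_nonneg[of q] norm1_nonneg[of d] by (simp add: C_def)
    ultimately show ?thesis
      using norm1_conv_deriv abs_le_norm1[OF x] order.trans by blast
  qed
  have "norm (conv_pow G (q + scale \<alpha> d) n x - conv_pow G (q + scale \<beta> d) n x)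
      \<le> real n * C ^ n * norm (\<alpha> - \<beta>)"
    by (rule field_differentiable_bound[of "{\<theta> - 1<..<\<theta> + 1}" _ "\<lambda>\<eta>. conv_deriv G (q + scale \<eta> d) d n x"])
      (use ab bound in \<open>auto intro: DERIV_conv_pow[THEN DERIV_subset]\<close>)
  then show "\<bar>conv_pow G (q + scale \<alpha> d) n x / fact n - conv_pow G (q + scale \<beta> d) n x / fact n\<bar>
      \<le> real n * C ^ n / fact n * \<bar>\<alpha> - \<beta>\<bar>"
    by (simp add: diff_divide_distrib[symmetric] field_simps)
qed

lemma conv_eq_sum_points: "f \<star> d = (\<Sum>s\<in>carrier G. scale (d s) (f \<star> point s))"
proof -
  have "f \<star> d = f \<star> (\<Sum>s\<in>carrier G. scale (d s) (point s))"
  proof (rule conv_cong)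
    fix x assume "x \<in> carrier G"
    then show "d x = (\<Sum>s\<in>carrier G. scale (d s) (point s)) x"
      by (simp add: fun_apply point_def if_distrib cong: if_cong)
  qed (auto intro: is_group)
  then show ?thesis
    by (simp add: conv_sum_right conv_scale_right)
qed

lemma conv_deriv_eq_sum_points:
  "conv_deriv G q d n = (\<Sum>s\<in>carrier G. scale (d s) (conv_deriv G q (point s) n))"
proof (induction n)
  case 0
  then show ?case by (simp add: fun_eq_iff fun_apply)
next
  case (Suc n)
  then show ?case
    by (simp add: conv_eq_sum_points[of _ d] conv_sum_left conv_scale_left scale_add sum.distrib)
qed

text \<open>Linearity in the direction reduces raising several rates to inserting a single jump
  \<open>s\<close>.\<close>

lemma conv_exp_deriv_eq_sum_points:
  assumes "x \<in> carrier G"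
  shows "conv_exp_deriv G q d x = (\<Sum>s\<in>carrier G. d s * conv_exp_deriv G q (point s) x)"
proof -
  have "conv_exp_deriv G q d x = (\<Sum>n. \<Sum>s\<in>carrier G. d s * (conv_deriv G q (point s) n x / fact n))"
    unfolding conv_exp_deriv_def
    by (subst conv_deriv_eq_sum_points) (simp add: fun_apply sum_divide_distrib)
  also have "\<dots> = (\<Sum>s\<in>carrier G. \<Sum>n. d s * (conv_deriv G q (point s) n x / fact n))"
    using assms by (intro suminf_sum summable_mult summable_conv_exp_deriv)
  finally show ?thesis
    unfolding conv_exp_deriv_def
    by (simp only: suminf_mult[OF summable_conv_exp_deriv[OF assms]])
qed

text \<open>The term of index 0 vanishes. After the shift, index \<open>n\<close> counts the
  ordinary jumps around the extra one.\<close>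

lemma conv_exp_deriv_sums:
  assumes "x \<in> carrier G"
  shows "(\<lambda>n. conv_deriv G q d (Suc n) x / fact (Suc n)) sums conv_exp_deriv G q d x"
  using summable_sums[OF summable_conv_exp_deriv[OF assms, of q d]]
  by (subst sums_Suc_iff) (simp add: conv_exp_deriv_def zero_fun_apply)

lemma conv_exp_sums:
  assumes "x \<in> carrier G"
  shows "(\<lambda>n. conv_pow G q n x / fact n) sums conv_exp G q x"
  using summable_sums[OF summable_conv_exp[OF assms, of q]] by (simp add: conv_exp_def)

lemma mass_conv_exp: "mass G (conv_exp G q) = exp (mass G q)"
proof -
  have "(\<lambda>n. mass G (conv_pow G q n) / fact n) sums mass G (conv_exp G q)"
    unfolding mass_def sum_divide_distrib by (intro sums_sum conv_exp_sums)
  moreover have "(\<lambda>n. mass G (conv_pow G q n) / fact n) sums exp (mass G q)"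
    using exp_converges[of "mass G q"] by (simp add: mass_conv_pow divide_inverse mult.commute)
  ultimately show ?thesis by (rule sums_unique2)
qed

end

lemma even_power_midpoint: "((a + b) / 2) ^ (2 * m) \<le> (a ^ (2 * m) + b ^ (2 * m)) / 2" for a b :: real
proof -
  have "convex_on UNIV (\<lambda>x :: real. x ^ (2 * m))"
    by (rule convex_power_even) simp
  from convex_onD[OF this, of "1/2" a b] show ?thesis
    by (simp add: field_simps)
qed

text \<open>A convex function lies above its tangent at \<open>a\<close>.\<close>

lemma even_power_Young: "2 * real m * a ^ (2 * m - 1) * b \<le> (2 * real m - 1) * a ^ (2 * m) + b ^ (2 * m)"
  if "0 < m" for a b :: real
proof -
  have c: "convex_on UNIV (\<lambda>x :: real. x ^ (2 * m))"
    by (rule convex_power_even) simp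
  have "b ^ (2 * m) - a ^ (2 * m) \<ge> (real (2 * m) * a ^ (2 * m - 1)) * (b - a)"
    by (rule convex_on_imp_above_tangent[OF c]) (auto intro!: derivative_eq_intros)
  moreover have "a ^ (2 * m - 1) * a = a ^ (2 * m)"
    using that by (metis Suc_pred' mult_pos_pos pos2 power_Suc2)
  moreover have "2 * real m * a ^ (2 * m - 1) * b =
      real (2 * m) * a ^ (2 * m - 1) * (b - a) + 2 * real m * (a ^ (2 * m - 1) * a)"
    by (simp add: algebra_simps)
  ultimately show ?thesis
    by (simp add: left_diff_distrib)
qed

section \<open>Monotonicity for groups with an inverted abelian subgroup of index two\<close>

locale inversion_group = finite_group G for G :: "('g, 'm) monoid_scheme" (structure) +
  fixes H :: "'g set" and b :: 'g
  assumes subgroup_H: "subgroup H G"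
    and H_comm: "x \<in> H \<Longrightarrow> y \<in> H \<Longrightarrow> x \<otimes> y = y \<otimes> x"
    and b_closed [simp]: "b \<in> carrier G"
    and b_notin: "b \<notin> H"
    and b_inverts: "x \<in> H \<Longrightarrow> b \<otimes> x = inv x \<otimes> b"
    and b_square: "b \<otimes> b \<in> H"
    and carrier_eq: "carrier G = H \<union> (\<lambda>x. x \<otimes> b) ` H"
begin

abbreviation A where "A \<equiv> G\<lparr>carrier := H\<rparr>"

lemma H_carrier [simp]: "x \<in> H \<Longrightarrow> x \<in> carrier G"
  using subgroup_H by (rule subgroup.mem_carrier)

lemma H_closed [simp]: "x \<in> H \<Longrightarrow> y \<in> H \<Longrightarrow> x \<otimes> y \<in> H" "x \<in> H \<Longrightarrow> inv x \<in> H" "\<one> \<in> H"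
  using subgroup_H by (auto intro: subgroup.m_closed subgroup.m_inv_closed subgroup.one_closed)

lemma inv_A [simp]: "x \<in> H \<Longrightarrow> inv\<^bsub>A\<^esub> x = inv x"
  using subgroup_H by (rule m_inv_consistent)

lemma finite_H: "finite H"
  using finite_carrier carrier_eq by simp

sublocale A: finite_comm_group A
proof -
  interpret A: group A
    using subgroup_H by (rule subgroup_imp_group)
  have "comm_group A"
    by (rule A.group_comm_groupI) (auto simp: H_comm)
  moreover have "finite_group_axioms A"
    by unfold_locales (simp add: finite_H)
  ultimately show "finite_comm_group A"
    by (intro finite_comm_group.intro finite_group.intro) (auto simp: comm_group_def)
qed

text \<open>\<open>b\<close> commutes with its own square but also inverts it.\<close>

lemma square_inverse: "inv (b \<otimes> b) = b \<otimes> b"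
proof -
  have "inv (b \<otimes> b) \<otimes> b = b \<otimes> b \<otimes> b"
    using b_inverts[OF b_square] by (simp add: m_assoc)
  then show ?thesis by (simp del: m_assoc)
qed

lemma inv_b: "inv b = b \<otimes> b \<otimes> b"
proof -
  have "inv (b \<otimes> b) \<otimes> b = inv b"
    by (simp add: inv_mult_group m_assoc)
  then show ?thesis
    by (simp only: square_inverse)
qed

lemma inv_b_move:
  assumes "x \<in> H" shows "inv b \<otimes> x = inv x \<otimes> inv b"
proof -
  have "inv (inv x \<otimes> b) = inv (b \<otimes> x)"
    using b_inverts[OF assms] by simp
  then show ?thesis
    using assms by (simp add: inv_mult_group)
qed

lemma inv_coset: "x \<in> H \<Longrightarrow> inv (x \<otimes> b) = x \<otimes> (b \<otimes> b) \<otimes> b"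
  using inv_b_move[of "inv x"] by (simp add: inv_mult_group) (simp add: inv_b m_assoc)

lemma coset_notin:
  assumes "x \<in> H" shows "x \<otimes> b \<notin> H"
proof
  assume "x \<otimes> b \<in> H"
  then have "inv x \<otimes> (x \<otimes> b) \<in> H"
    by (rule H_closed(1)[OF H_closed(2)[OF assms]])
  moreover have "inv x \<otimes> (x \<otimes> b) = b"
    using assms by (simp add: m_assoc[symmetric])
  ultimately show False
    using b_notin by simp
qed

lemma coset_inj: "inj_on (\<lambda>x. x \<otimes> b) H"
  by (auto simp: inj_on_def)

lemma sum_carrier: "(\<Sum>x\<in>carrier G. f x) = (\<Sum>x\<in>H. f x) + (\<Sum>x\<in>H. f (x \<otimes> b))"
proof -
  have "(\<Sum>x\<in>carrier G. f x) = (\<Sum>x\<in>H. f x) + (\<Sum>x\<in>(\<lambda>x. x \<otimes> b) ` H. f x)"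
    unfolding carrier_eq using finite_H coset_notin by (intro sum.union_disjoint) auto
  then show ?thesis
    by (simp add: sum.reindex[OF coset_inj] o_def)
qed

lemma order_eq: "order G = 2 * card H"
  unfolding order_def using sum_carrier[of "\<lambda>_. 1 :: nat"] by simp

section \<open>Convolution in terms of the two cosets\<close>

definition even_part :: "('g \<Rightarrow> real) \<Rightarrow> 'g \<Rightarrow> real" where
  "even_part f = (\<lambda>x. if x \<in> H then f x else 0)"

text \<open>The coefficient \<open>f1\<close> in \<open>f = f0 + f1 b\<close>, moved to
  \<open>H\<close> so that all computations take place in the commutative group
  \<open>A\<close>.\<close>

definition odd_part :: "('g \<Rightarrow> real) \<Rightarrow> 'g \<Rightarrow> real" where
  "odd_part f = (\<lambda>x. if x \<in> H then f (x \<otimes> b) else 0)"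

definition square_invariant :: "('g \<Rightarrow> real) \<Rightarrow> bool" where
  "square_invariant f \<longleftrightarrow> (\<forall>x\<in>H. f (x \<otimes> (b \<otimes> b)) = f x)"

lemma square_invariantD: "square_invariant f \<Longrightarrow> x \<in> H \<Longrightarrow> f (x \<otimes> (b \<otimes> b)) = f x"
  by (simp add: square_invariant_def)

lemma parts_zero [simp]: "even_part 0 = 0" "odd_part 0 = 0"
  by (auto simp: even_part_def odd_part_def fun_eq_iff fun_apply)

lemma even_part_add: "even_part (f + g) = even_part f + even_part g"
  by (auto simp: even_part_def fun_eq_iff fun_apply)

lemma odd_part_add: "odd_part (f + g) = odd_part f + odd_part g"
  by (auto simp: odd_part_def fun_eq_iff fun_apply)

lemma mass_parts: "mass G f = mass A (even_part f) + mass A (odd_part f)"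
  by (simp add: mass_def sum_carrier even_part_def odd_part_def)

text \<open>Moving \<open>b\<close> across an element of \<open>H\<close> inverts it, so
  \<open>f1 b g1 b\<close> is \<open>f1\<close> convolved with the reflection of \<open>g1\<close>,
  times \<open>b \<otimes> b\<close>. The assumption lets \<open>g1\<close> absorb this
  square.\<close>

lemma even_part_conv:
  assumes "square_invariant (odd_part g)"
  shows "even_part (f \<star> g) =
    conv A (even_part f) (even_part g) + conv A (odd_part f) (reflect A (odd_part g))"
proof
  fix x
  show "even_part (f \<star> g) x =
    (conv A (even_part f) (even_part g) + conv A (odd_part f) (reflect A (odd_part g))) x"
  proof (cases "x \<in> H")
    case x: True
    have "g (inv (y \<otimes> b) \<otimes> x) = odd_part g (inv (inv y \<otimes> x))" if y: "y \<in> H" for y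
    proof -
      have "inv (y \<otimes> b) \<otimes> x = inv b \<otimes> (inv y \<otimes> x)"
        using x y by (simp add: inv_mult_group m_assoc)
      also have "\<dots> = inv (inv y \<otimes> x) \<otimes> (b \<otimes> b) \<otimes> b"
        using x y by (subst inv_b_move) (auto simp: inv_b m_assoc)
      finally have "g (inv (y \<otimes> b) \<otimes> x) = odd_part g (inv (inv y \<otimes> x) \<otimes> (b \<otimes> b))"
        using x y b_square by (simp add: odd_part_def)
      then show ?thesis
        using x y square_invariantD[OF assms] by simp
    qed
    then show ?thesis
      using x by (simp add: even_part_def[of "f \<star> g"] conv_eq sum_carrier fun_apply A.conv_eq)
        (simp add: even_part_def odd_part_def reflect_def)
  qed (simp add: even_part_def conv_outside fun_apply)
qed

lemma odd_part_conv:
  "odd_part (f \<star> g) =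
    conv A (even_part f) (odd_part g) + conv A (odd_part f) (reflect A (even_part g))"
proof
  fix x
  show "odd_part (f \<star> g) x =
    (conv A (even_part f) (odd_part g) + conv A (odd_part f) (reflect A (even_part g))) x"
  proof (cases "x \<in> H")
    case x: True
    have "inv (y \<otimes> b) \<otimes> (x \<otimes> b) = inv (inv y \<otimes> x)" if y: "y \<in> H" for y
    proof -
      have "inv (y \<otimes> b) \<otimes> (x \<otimes> b) = inv b \<otimes> (inv y \<otimes> x) \<otimes> b"
        using x y by (simp add: inv_mult_group m_assoc)
      also have "\<dots> = inv (inv y \<otimes> x) \<otimes> inv b \<otimes> b"
        using x y by (subst inv_b_move) auto
      finally show ?thesis
        using x y by (simp add: m_assoc)
    qed
    moreover have "inv y \<otimes> (x \<otimes> b) = inv y \<otimes> x \<otimes> b" if "y \<in> H" for y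
      using that x by (simp add: m_assoc)
    ultimately show ?thesis
      using x by (simp add: odd_part_def[of "f \<star> g"] conv_eq sum_carrier fun_apply A.conv_eq)
        (simp add: even_part_def odd_part_def reflect_def)
  qed (simp add: odd_part_def conv_outside fun_apply)
qed

lemma parts_conv_point_H:
  assumes "c \<in> H"
  shows "even_part (f \<star> point c) = conv A (even_part f) (point c)"
    "odd_part (f \<star> point c) = conv A (odd_part f) (point (inv c))"
proof -
  have "x \<otimes> b \<otimes> inv c = x \<otimes> c \<otimes> b" if "x \<in> H" for x
    using that assms b_inverts[of "inv c"] by (simp add: m_assoc)
  then show "odd_part (f \<star> point c) = conv A (odd_part f) (point (inv c))"
    using assms
    by (auto simp: fun_eq_iff odd_part_def conv_outside conv_point_right A.conv_point_right)
  show "even_part (f \<star> point c) = conv A (even_part f) (point c)"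
    using assms
    by (auto simp: fun_eq_iff even_part_def conv_outside conv_point_right A.conv_point_right)
qed

lemma parts_conv_point_coset:
  assumes "c \<in> H" "square_invariant (odd_part f)"
  shows "even_part (f \<star> point (c \<otimes> b)) = conv A (odd_part f) (point (inv c))"
    "odd_part (f \<star> point (c \<otimes> b)) = conv A (even_part f) (point c)"
proof -
  have "x \<otimes> b \<otimes> inv (c \<otimes> b) = x \<otimes> inv c" if "x \<in> H" for x
  proof -
    have "b \<otimes> (inv b \<otimes> inv c) = inv c"
      using assms by (simp add: m_assoc[symmetric])
    then show ?thesis
      using that assms by (simp add: inv_mult_group m_assoc)
  qed
  then show "odd_part (f \<star> point (c \<otimes> b)) = conv A (even_part f) (point c)"
    using assms
    by (auto simp: fun_eq_iff odd_part_def even_part_def conv_outside conv_point_right A.conv_point_right)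
  have "f (x \<otimes> inv (c \<otimes> b)) = odd_part f (x \<otimes> c)" if "x \<in> H" for x
  proof -
    have "x \<otimes> inv (c \<otimes> b) = (x \<otimes> c) \<otimes> (b \<otimes> b) \<otimes> b"
      using that assms b_square by (simp add: inv_coset m_assoc)
    then have "f (x \<otimes> inv (c \<otimes> b)) = odd_part f ((x \<otimes> c) \<otimes> (b \<otimes> b))"
      using that assms b_square by (simp add: odd_part_def)
    then show ?thesis
      using that assms square_invariantD[OF assms(2)] by simp
  qed
  then show "even_part (f \<star> point (c \<otimes> b)) = conv A (odd_part f) (point (inv c))"
    using assms
    by (auto simp: fun_eq_iff even_part_def conv_outside conv_point_right A.conv_point_right)
qed

lemma square_invariant_conv:
  assumes "square_invariant f" shows "square_invariant (conv A f g)"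
proof -
  have "conv A g f (x \<otimes> (b \<otimes> b)) = conv A g f x" if x: "x \<in> H" for x
  proof -
    have "f (inv y \<otimes> (x \<otimes> (b \<otimes> b))) = f (inv y \<otimes> x)" if y: "y \<in> H" for y
    proof -
      have "inv y \<otimes> (x \<otimes> (b \<otimes> b)) = inv y \<otimes> x \<otimes> (b \<otimes> b)"
        using x y b_square by (simp add: m_assoc)
      then show ?thesis
        using x y square_invariantD[OF assms, of "inv y \<otimes> x"] by simp
    qed
    then show ?thesis
      using x b_square by (simp add: A.conv_eq)
  qed
  then show ?thesis
    by (simp add: square_invariant_def A.conv_comm[of f])
qed

lemma even_part_scale_point: "even_part (scale k (point \<one>)) = scale k (point \<one>)"
  by (auto simp: even_part_def fun_eq_iff fun_apply point_def)

lemma odd_part_scale_point: "odd_part (scale k (point \<one>)) = 0"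
  using coset_notin by (auto simp: odd_part_def fun_eq_iff fun_apply point_def) (metis H_closed(3))

end

text \<open>The rate \<open>k\<close> of the identity has no effect on the law of the walk; it is so large that the
  even part of \<open>q\<close> becomes positive definite.\<close>

locale lazy_rates = inversion_group +
  fixes r :: "'a \<Rightarrow> real" and k :: real
  assumes nonneg: "x \<in> carrier G \<Longrightarrow> 0 \<le> r x"
    and symmetric: "x \<in> carrier G \<Longrightarrow> r (inv x) = r x"
    and lazy: "mass G r \<le> k"
begin

definition q :: "'a \<Rightarrow> real" where "q = r + scale k (point \<one>)"

abbreviation q0 where "q0 \<equiv> even_part q"
abbreviation q1 where "q1 \<equiv> odd_part q"
abbreviation w where "w \<equiv> conv A q1 (reflect A q1)"
abbreviation u where "u \<equiv> A.ev q0 w"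
abbreviation v where "v \<equiv> A.od q0 w"

lemma q0_eq: "q0 = even_part r + scale k (point \<one>)"
  unfolding q_def even_part_add even_part_scale_point ..

lemma q1_eq: "q1 = odd_part r"
  unfolding q_def odd_part_add odd_part_scale_point by simp

lemma r_parts_nonneg: "0 \<le> even_part r x" "0 \<le> odd_part r x"
  by (auto simp: even_part_def odd_part_def nonneg)

lemma mass_r_parts_nonneg: "0 \<le> mass A (even_part r)" "0 \<le> mass A (odd_part r)"
  by (auto simp: mass_def r_parts_nonneg intro!: sum_nonneg)

lemma q0_dominated: "A.dominated q0 q0"
proof -
  have "reflect A (even_part r) = even_part r"
    by (auto simp: reflect_def even_part_def symmetric)
  moreover have "mass A (even_part r) \<le> k"
    using lazy mass_r_parts_nonneg by (simp add: mass_parts)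
  ultimately show ?thesis
    using A.dominated_self_lazy[of "even_part r" k] r_parts_nonneg by (simp add: q0_eq)
qed

text \<open>As \<open>b\<close> inverts \<open>H\<close>, this is what makes \<open>q0\<close>
  central.\<close>

lemma reflect_q0: "reflect A q0 = q0"
proof -
  have "q (inv x) = q x" if "x \<in> H" for x
    using that by (auto simp: q_def fun_apply symmetric point_def)
  then show ?thesis
    by (auto simp: reflect_def even_part_def)
qed

text \<open>The inverse of \<open>x \<otimes> b\<close> is
  \<open>x \<otimes> (b \<otimes> b) \<otimes> b\<close>, so on the coset symmetry of the rates is
  invariance under \<open>b \<otimes> b\<close>.\<close>

lemma square_invariant_q1: "square_invariant q1"
  unfolding square_invariant_def q1_eq
proof
  fix x assume x: "x \<in> H"
  have "r (x \<otimes> (b \<otimes> b) \<otimes> b) = r (x \<otimes> b)"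
    using symmetric[of "x \<otimes> b"] x by (simp add: inv_coset)
  then show "odd_part r (x \<otimes> (b \<otimes> b)) = odd_part r x"
    using x b_square by (simp add: odd_part_def)
qed

lemma reflect_w: "reflect A w = w"
  by (simp add: A.reflect_conv' A.conv_comm)

lemma w_dominated: "A.dominated w w"
  by (rule A.dominated.base) simp

text \<open>The square of the transform of \<open>q1\<close> and its squared modulus differ by a
  phase.\<close>

lemma q1_q1_dominated: "A.dominated (conv A q1 q1) w"
  using A.dominated.base[of q1 "reflect A q1"] by (simp add: A.conv_comm)

lemma reflect_v: "reflect A (v n) = v n"
  by (intro A.reflect_ev_od reflect_q0 reflect_w)

text \<open>In the group algebra \<open>q1 b\<close> commutes with \<open>q0\<close> and squares to
  \<open>w\<close>, so it takes the place of \<open>\<surd>w\<close> in the expansion behind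
  \<open>ev\<close> and \<open>od\<close>.\<close>

lemma parts_conv_pow: "even_part (conv_pow G q n) = u n" "odd_part (conv_pow G q n) = conv A q1 (v n)"
proof (induction n)
  case 0
  {
    case 1
    show ?case using even_part_scale_point[of 1] by (simp add: scale_def)
  next
    case 2
    show ?case using odd_part_scale_point[of 1] by (simp add: scale_def)
  }
next
  case (Suc n)
  {
    case 1
    show ?case
      using Suc by (simp add: even_part_conv square_invariant_q1 A.conv_ac)
  next
    case 2
    show ?case
      using Suc by (simp add: odd_part_conv reflect_q0 A.conv_distribs A.conv_ac)
  }
qed

lemma square_invariant_odd_part: "square_invariant (odd_part (conv_pow G q n))"
  unfolding parts_conv_pow by (intro square_invariant_conv square_invariant_q1)

text \<open>The jump \<open>c\<close> stands between two powers of the form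
  \<open>u + v q1 b\<close>. Moved to the left, it becomes \<open>inv c\<close> exactly in the terms
  whose left factor is odd; two odd factors produce \<open>w\<close>.\<close>

lemma parts_conv_deriv_H:
  assumes c: "c \<in> H"
  shows "even_part (conv_deriv G q (point c) (Suc n)) =
      conv A (A.cauchy u u n) (point c) + conv A (conv A w (A.cauchy v v n)) (point (inv c))"
    "odd_part (conv_deriv G q (point c) (Suc n)) =
      conv A q1 (conv A (A.cauchy u v n) (point c) + conv A (A.cauchy v u n) (point (inv c)))"
proof (induction n)
  case 0
  {
    case 1
    show ?case
      unfolding conv_deriv.simps even_part_add even_part_conv[OF square_invariant_q1]
        parts_conv_point_H[OF c] parts_conv_pow A.cauchy_0
      by simp
  next
    case 2
    show ?case
      unfolding conv_deriv.simps conv_zero_left odd_part_add parts_zero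
        parts_conv_point_H[OF c] parts_conv_pow A.cauchy_0
      by simp
  }
next
  case (Suc n)
  {
    case 1
    show ?case
      unfolding conv_deriv.simps(2)[of _ _ _ "Suc n"] even_part_add even_part_conv[OF square_invariant_q1]
        parts_conv_point_H[OF c] Suc parts_conv_pow A.cauchy_ev_ev_Suc A.cauchy_od_Suc
      by (simp only: A.conv_distribs A.conv_ac add_ac)
  next
    case 2
    show ?case
      unfolding conv_deriv.simps(2)[of _ _ _ "Suc n"] odd_part_add odd_part_conv[of _ q]
        parts_conv_point_H[OF c] Suc parts_conv_pow A.cauchy_od_ev_Suc A.cauchy_od_Suc reflect_q0
      by (simp only: A.conv_distribs A.conv_ac add_ac)
  }
qed

text \<open>Compared with \<open>c\<close> in \<open>H\<close>, the additional \<open>b\<close>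
  interchanges the two parts, and a factor \<open>q1\<close> from the right crosses one more
  \<open>b\<close>. It is reflected once more, so \<open>w\<close> turns into the convolution square
  of \<open>q1\<close>.\<close>

lemma parts_conv_deriv_coset:
  assumes c: "c \<in> H"
  shows "odd_part (conv_deriv G q (point (c \<otimes> b)) (Suc n)) =
      conv A (A.cauchy u u n) (point c) + conv A (conv A (conv A q1 q1) (A.cauchy v v n)) (point (inv c))"
    "even_part (conv_deriv G q (point (c \<otimes> b)) (Suc n)) =
      conv A (conv A (reflect A q1) (A.cauchy u v n)) (point c) +
      conv A (conv A q1 (A.cauchy v u n)) (point (inv c))"
proof (induction n)
  case 0
  {
    case 1
    show ?case
      unfolding conv_deriv.simps conv_zero_left odd_part_add parts_zero
        parts_conv_point_coset[OF c square_invariant_odd_part] parts_conv_pow A.cauchy_0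
      by simp
  next
    case 2
    show ?case
      unfolding conv_deriv.simps even_part_add even_part_conv[OF square_invariant_q1]
        parts_conv_point_coset[OF c square_invariant_odd_part] parts_conv_pow A.cauchy_0
      by simp
  }
next
  case (Suc n)
  {
    case 1
    show ?case
      unfolding conv_deriv.simps(2)[of _ _ _ "Suc n"] odd_part_add odd_part_conv[of _ q]
        parts_conv_point_coset[OF c square_invariant_odd_part] Suc parts_conv_pow
        A.cauchy_ev_ev_Suc A.cauchy_od_Suc reflect_q0
      by (simp only: A.conv_distribs A.conv_ac add_ac)
  next
    case 2
    show ?case
      unfolding conv_deriv.simps(2)[of _ _ _ "Suc n"] even_part_add even_part_conv[OF square_invariant_q1]
        parts_conv_point_coset[OF c square_invariant_odd_part] Suc parts_conv_pow
        A.cauchy_od_ev_Suc A.cauchy_od_Suc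
      by (simp only: A.conv_distribs A.conv_ac add_ac)
  }
qed

section \<open>The law and the law with one extra jump\<close>

abbreviation law where "law \<equiv> walk_law G q"

text \<open>The law with the extra jump \<open>s\<close>. The remaining term \<open>- law x\<close>
  of the derivative comes from the normalising factor in \<open>walk_law\<close>.\<close>

definition law_deriv :: "'a \<Rightarrow> 'a \<Rightarrow> real" where
  "law_deriv s x = exp (- mass G q) * conv_exp_deriv G q (point s) x"

lemma law_sums:
  assumes "x \<in> H"
  shows "(\<lambda>n. exp (- mass G q) * (u n x / fact n)) sums law x"
    "(\<lambda>n. exp (- mass G q) * (conv A q1 (v n) x / fact n)) sums law (x \<otimes> b)"
proof -
  have "conv_pow G q n x = u n x" "conv_pow G q n (x \<otimes> b) = conv A q1 (v n) x" for n
    using fun_cong[OF parts_conv_pow(1)[of n], of x] fun_cong[OF parts_conv_pow(2)[of n], of x] assms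
    by (simp_all add: even_part_def[of "conv_pow G q n"] odd_part_def[of "conv_pow G q n"])
  then show "(\<lambda>n. exp (- mass G q) * (u n x / fact n)) sums law x"
    "(\<lambda>n. exp (- mass G q) * (conv A q1 (v n) x / fact n)) sums law (x \<otimes> b)"
    using sums_mult[OF conv_exp_sums[of x q], of "exp (- mass G q)"]
      sums_mult[OF conv_exp_sums[of "x \<otimes> b" q], of "exp (- mass G q)"] assms
    by (simp_all add: walk_law_def)
qed

lemma law_deriv_sums:
  assumes "x \<in> H"
  shows "(\<lambda>n. exp (- mass G q) * (even_part (conv_deriv G q (point s) (Suc n)) x / fact (Suc n))) sums law_deriv s x"
    "(\<lambda>n. exp (- mass G q) * (odd_part (conv_deriv G q (point s) (Suc n)) x / fact (Suc n))) sums law_deriv s (x \<otimes> b)"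
  using sums_mult[OF conv_exp_deriv_sums[of x q "point s"], of "exp (- mass G q)"]
      sums_mult[OF conv_exp_deriv_sums[of "x \<otimes> b" q "point s"], of "exp (- mass G q)"] assms
  by (simp_all add: law_deriv_def even_part_def odd_part_def del: conv_deriv.simps fact_Suc)

text \<open>Weighting the coset by -1 gives the \<open>n\<close>-th power of \<open>q\<close> the
  mass \<open>(mass A q0 - mass A q1) ^ n\<close>, which laziness makes nonnegative. The bound 1/2
  is \<open>1 / real (order G)\<close> summed over \<open>H\<close>.\<close>

lemma mass_law_H: "1 / 2 \<le> mass A law"
proof -
  have q: "0 \<le> mass A q1" "mass A q1 \<le> mass A q0"
    using mass_r_parts_nonneg lazy
    by (auto simp: q0_eq q1_eq mass_add mass_scale A.mass_point[of \<one>, simplified] mass_parts[of r])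
  have eq: "mass A (u n) - mass A q1 * mass A (v n) = (mass A q0 - mass A q1) ^ n" for n
    by (induction n)
      (simp_all add: mass_add A.mass_conv A.mass_reflect A.mass_point[of \<one>, simplified] algebra_simps)
  have "mass A (conv A q1 (v n)) \<le> mass A (u n)" for n
  proof -
    have "0 \<le> mass A (u n) - mass A q1 * mass A (v n)"
      unfolding eq using q(2) by (intro zero_le_power) (rule diff_ge_0_iff_ge[THEN iffD2])
    then show ?thesis
      unfolding A.mass_conv by (rule diff_ge_0_iff_ge[THEN iffD1])
  qed
  then have le: "exp (- mass G q) * (mass A (conv A q1 (v n)) / fact n) \<le> exp (- mass G q) * (mass A (u n) / fact n)" for n
    by (intro mult_left_mono divide_right_mono) auto
  have sums: "(\<lambda>n. exp (- mass G q) * (mass A (u n) / fact n)) sums mass A law"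
    "(\<lambda>n. exp (- mass G q) * (mass A (conv A q1 (v n)) / fact n)) sums mass A (\<lambda>x. law (x \<otimes> b))"
    unfolding mass_def[of A] sum_divide_distrib sum_distrib_left
    by (intro sums_sum law_sums; simp)+
  have "mass A (\<lambda>x. law (x \<otimes> b)) \<le> mass A law"
    by (rule sums_le[OF le sums(2) sums(1)])
  moreover have "mass A law + mass A (\<lambda>x. law (x \<otimes> b)) = 1"
  proof -
    have "law = scale (exp (- mass G q)) (conv_exp G q)"
      by (rule ext) (simp add: scale_apply[of _ _ "_ :: 'a"] walk_law_def)
    then have "mass G law = 1"
      by (simp add: mass_scale mass_conv_exp exp_minus)
    then show ?thesis
      by (simp add: mass_def sum_carrier)
  qed
  ultimately show ?thesis by simp
qed

text \<open>Here \<omega> will be \<open>w\<close> for an extra jump in \<open>H\<close>, with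
  \<open>D\<close> the even part, and the convolution square of \<open>q1\<close> otherwise, with
  \<open>D\<close> the odd part. Both are compared with the even part of the law.\<close>

lemma dominated_part:
  assumes "A.dominated \<omega> w" "mass A \<omega> = mass A w" "c \<in> H"
    and "\<And>x. x \<in> H \<Longrightarrow> (\<lambda>n. exp (- mass G q) *
      ((conv A (A.cauchy u u n) (point c) + conv A (conv A \<omega> (A.cauchy v v n)) (point (inv c))) x / fact (Suc n))) sums D x"
  shows "(\<Sum>x\<in>H. (D x - 1 / real (order G)) ^ n) \<le> (\<Sum>x\<in>H. (law x - 1 / real (order G)) ^ n)"
proof -
  \<comment> \<open>The factor \<open>real (Suc k)\<close> from \<open>dominated_cauchy\<close>
    cancels against \<open>fact (Suc k)\<close> and leaves the coefficient of the law.\<close>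
  define a where "a k = exp (- mass G q) / fact (Suc k)" for k
  have "(\<Sum>x\<in>carrier A. (D x - 1 / real (order G)) ^ n) \<le> (\<Sum>x\<in>carrier A. (law x - 1 / real (order G)) ^ n)"
  proof (rule A.dominated_series)
    let ?s = "\<lambda>k. conv A (A.cauchy u u k) (point c) + conv A (conv A \<omega> (A.cauchy v v k)) (point (inv c))"
    let ?v = "\<lambda>k. scale (real (Suc k)) (u k)"
    show "A.dominated (scale (a k) (?s k)) (scale (a k) (?v k))" for k
      using assms by (intro A.dominated.scale A.dominated_cauchy q0_dominated w_dominated)
        (auto simp: a_def)
    show "mass A (scale (a k) (?s k)) = mass A (scale (a k) (?v k))" for k
      unfolding mass_scale[of _ "a k"] using assms A.mass_cauchy[of \<omega> w c "inv c" q0 k] by simp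
    show "(\<lambda>k. scale (a k) (?s k) x) sums D x" if "x \<in> carrier A" for x
      using assms(4)[of x] that by (simp add: a_def scale_apply)
    have a: "a k * (real (Suc k) * y) = exp (- mass G q) * (y / fact k)" for k y
    proof -
      have "a k * (real (Suc k) * y) = (real (Suc k) * (exp (- mass G q) * y)) / (real (Suc k) * fact k)"
        by (simp add: a_def)
      also have "\<dots> = exp (- mass G q) * y / fact k"
        by (rule mult_divide_mult_cancel_left) simp
      finally show ?thesis by simp
    qed
    show "(\<lambda>k. scale (a k) (?v k) x) sums law x" if "x \<in> carrier A" for x
      using law_sums(1)[of x] that unfolding scale_apply a by simp
    have "0 < card H"
      using A.card_pos by simp
    then show "1 / real (order G) * real (card (carrier A)) \<le> mass A law"
      using mass_law_H by (simp add: order_eq)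
  qed
  then show ?thesis by simp
qed

text \<open>\<phi> and \<psi> will be translations or reflections of \<open>H\<close>, which
  preserve sums, so convexity of the even power suffices.\<close>

lemma averaged_part:
  assumes "\<And>x. x \<in> H \<Longrightarrow> D x = (F (\<phi> x) + F (\<psi> x)) / 2"
    and "\<And>f :: 'a \<Rightarrow> real. (\<Sum>x\<in>H. f (\<phi> x)) = (\<Sum>x\<in>H. f x)"
    and "\<And>f :: 'a \<Rightarrow> real. (\<Sum>x\<in>H. f (\<psi> x)) = (\<Sum>x\<in>H. f x)"
  shows "(\<Sum>x\<in>H. (D x - \<beta>) ^ (2 * m)) \<le> (\<Sum>x\<in>H. (F x - \<beta> :: real) ^ (2 * m))"
proof -
  have "(\<Sum>x\<in>H. (D x - \<beta>) ^ (2 * m)) \<le>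
      (\<Sum>x\<in>H. ((F (\<phi> x) - \<beta>) ^ (2 * m) + (F (\<psi> x) - \<beta>) ^ (2 * m)) / 2)"
  proof (rule sum_mono)
    fix x assume "x \<in> H"
    then have "D x - \<beta> = ((F (\<phi> x) - \<beta>) + (F (\<psi> x) - \<beta>)) / 2"
      using assms(1) by simp
    then show "(D x - \<beta>) ^ (2 * m) \<le> ((F (\<phi> x) - \<beta>) ^ (2 * m) + (F (\<psi> x) - \<beta>) ^ (2 * m)) / 2"
      by (simp only: even_power_midpoint)
  qed
  also have "\<dots> = (\<Sum>x\<in>H. (F x - \<beta>) ^ (2 * m))"
    using assms(2,3)[of "\<lambda>y. (F y - \<beta>) ^ (2 * m)"]
    by (simp add: sum_divide_distrib[symmetric] sum.distrib)
  finally show ?thesis .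
qed

text \<open>The factor of \<open>cauchy_ev_od\<close>, set against \<open>fact (Suc n)\<close> in
  place of \<open>fact n\<close>, leaves 1/2.\<close>

lemma averaged_series:
  fixes x :: 'a
  assumes "\<And>n. E n = scale (real (Suc n) / 2) (e n)"
    and "(\<lambda>n. exp (- mass G q) * (e n x / fact n)) sums S"
    and "(\<lambda>n. exp (- mass G q) * (E n x / fact (Suc n))) sums S'"
  shows "S' = S / 2"
proof -
  have "exp (- mass G q) * (E n x / fact (Suc n)) = exp (- mass G q) * (e n x / fact n) / 2" for n
  proof -
    have "E n x / fact (Suc n) = (real (Suc n) * e n x) / (real (Suc n) * fact n) / 2"
      by (simp add: assms(1) fun_apply)
    also have "\<dots> = e n x / fact n / 2"
      by (subst mult_divide_mult_cancel_left) auto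
    finally show ?thesis by simp
  qed
  then show ?thesis
    using sums_unique2[OF assms(3)] sums_divide[OF assms(2), of 2] by simp
qed

lemma sum_translate_H:
  assumes "c \<in> H"
  shows "(\<Sum>x\<in>H. f (x \<otimes> c)) = (\<Sum>x\<in>H. f x)"
  using A.sum_translate_right[of c f] assms by simp

lemma odd_law_deriv_H:
  assumes c: "c \<in> H" and x: "x \<in> H"
  shows "law_deriv c (x \<otimes> b) = (law (x \<otimes> inv c \<otimes> b) + law (x \<otimes> c \<otimes> b)) / 2"
proof (rule averaged_series)
  let ?e = "\<lambda>n. conv A (conv A q1 (v n)) (point c) + conv A (conv A q1 (v n)) (point (inv c))"
  show "odd_part (conv_deriv G q (point c) (Suc n)) = scale (real (Suc n) / 2) (?e n)" for n
    unfolding parts_conv_deriv_H[OF c] A.cauchy_comm[of v] A.cauchy_ev_od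
    by (simp only: A.conv_distribs A.conv_assoc scale_add)
  show "(\<lambda>n. exp (- mass G q) * (?e n x / fact n)) sums (law (x \<otimes> inv c \<otimes> b) + law (x \<otimes> c \<otimes> b))"
    using sums_add[OF law_sums(2)[of "x \<otimes> inv c"] law_sums(2)[of "x \<otimes> c"]] c x
    by (simp add: plus_fun_apply[of "conv A _ _"] A.conv_point_right add_divide_distrib distrib_left)
qed (rule law_deriv_sums[OF x])

lemma even_law_deriv_coset:
  assumes c: "c \<in> H" and x: "x \<in> H"
  shows "law_deriv (c \<otimes> b) x = (law (inv (x \<otimes> inv c) \<otimes> b) + law (x \<otimes> c \<otimes> b)) / 2"
proof (rule averaged_series)
  let ?e = "\<lambda>n. conv A (reflect A (conv A q1 (v n))) (point c) + conv A (conv A q1 (v n)) (point (inv c))"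
  show "even_part (conv_deriv G q (point (c \<otimes> b)) (Suc n)) = scale (real (Suc n) / 2) (?e n)" for n
    unfolding parts_conv_deriv_coset[OF c] A.cauchy_comm[of v] A.cauchy_ev_od A.reflect_conv' reflect_v
    by (simp only: A.conv_distribs A.conv_assoc scale_add)
  show "(\<lambda>n. exp (- mass G q) * (?e n x / fact n)) sums (law (inv (x \<otimes> inv c) \<otimes> b) + law (x \<otimes> c \<otimes> b))"
    using sums_add[OF law_sums(2)[of "inv (x \<otimes> inv c)"] law_sums(2)[of "x \<otimes> c"]] c x
    by (simp add: plus_fun_apply[of "conv A _ _"] A.conv_point_right add_divide_distrib distrib_left
      reflect_def[of A "conv A _ _"])
qed (rule law_deriv_sums[OF x])

text \<open>A jump in \<open>H\<close> compares each part with the same part of the law; a jump in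
  the other coset interchanges them, which the sum over the whole group does not notice.\<close>

lemma law_deriv_power_sum:
  assumes s: "s \<in> carrier G"
  shows "(\<Sum>x\<in>carrier G. (law_deriv s x - 1 / real (order G)) ^ (2 * m))
    \<le> (\<Sum>x\<in>carrier G. (law x - 1 / real (order G)) ^ (2 * m))"
proof -
  let ?\<beta> = "1 / real (order G)"
  consider "s \<in> H" | c where "c \<in> H" "s = c \<otimes> b"
    using s unfolding carrier_eq by auto
  then show ?thesis
  proof cases
    case 1
    have "(\<Sum>x\<in>H. (law_deriv s x - ?\<beta>) ^ (2 * m)) \<le> (\<Sum>x\<in>H. (law x - ?\<beta>) ^ (2 * m))"
      by (rule dominated_part[OF w_dominated HOL.refl 1])
        (use law_deriv_sums(1)[of _ s] in \<open>simp only: parts_conv_deriv_H[OF 1]\<close>)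
    moreover have "(\<Sum>x\<in>H. (law_deriv s (x \<otimes> b) - ?\<beta>) ^ (2 * m)) \<le> (\<Sum>x\<in>H. (law (x \<otimes> b) - ?\<beta>) ^ (2 * m))"
      by (rule averaged_part[where F = "\<lambda>x. law (x \<otimes> b)", OF odd_law_deriv_H[OF 1]])
        (use 1 in \<open>auto intro!: sum_translate_H\<close>)
    ultimately show ?thesis
      unfolding sum_carrier by simp
  next
    case 2
    have "(\<Sum>x\<in>H. (law_deriv s (x \<otimes> b) - ?\<beta>) ^ (2 * m)) \<le> (\<Sum>x\<in>H. (law x - ?\<beta>) ^ (2 * m))"
      by (rule dominated_part[OF q1_q1_dominated _ 2(1)])
        (use law_deriv_sums(2)[of _ s] 2 in
          \<open>simp_all only: parts_conv_deriv_coset[OF 2(1)] A.mass_conv A.mass_reflect\<close>)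
    moreover have "(\<Sum>x\<in>H. (law_deriv s x - ?\<beta>) ^ (2 * m)) \<le> (\<Sum>x\<in>H. (law (x \<otimes> b) - ?\<beta>) ^ (2 * m))"
      unfolding 2(2)
    proof (rule averaged_part[where F = "\<lambda>x. law (x \<otimes> b)", OF even_law_deriv_coset[OF 2(1)]])
      show "(\<Sum>x\<in>H. f (inv (x \<otimes> inv c))) = (\<Sum>x\<in>H. f x)" for f :: "'a \<Rightarrow> real"
        using sum_translate_H[of "inv c" "\<lambda>x. f (inv x)"] A.sum_inverse[of f] 2 by simp
    qed (use 2 in \<open>auto intro!: sum_translate_H\<close>)
    ultimately show ?thesis
      unfolding sum_carrier by simp
  qed
qed

end

section \<open>Integration along the segment between two rate collections\<close>

context inversion_group
begin

text \<open>All rates \<open>r + scale \<theta> d\<close> on the segment are at most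
  \<open>r'\<close>, so the same \<open>k\<close> makes each of them lazy.\<close>

lemma walk_law_power_sum_mono:
  assumes nonneg: "\<And>x. x \<in> carrier G \<Longrightarrow> 0 \<le> r x"
    and le: "\<And>x. x \<in> carrier G \<Longrightarrow> r x \<le> r' x"
    and sym: "\<And>x. x \<in> carrier G \<Longrightarrow> r (inv x) = r x" "\<And>x. x \<in> carrier G \<Longrightarrow> r' (inv x) = r' x"
    and lazy: "mass G r' \<le> k" and m: "0 < m"
  shows "(\<Sum>x\<in>carrier G. (walk_law G (r' + scale k (point \<one>)) x - 1 / real (order G)) ^ (2 * m))
    \<le> (\<Sum>x\<in>carrier G. (walk_law G (r + scale k (point \<one>)) x - 1 / real (order G)) ^ (2 * m))"
proof -
  define \<beta> where "\<beta> = 1 / real (order G)"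
  define d where "d = (\<lambda>x. r' x - r x)"
  define q where "q = r + scale k (point \<one>)"
  define L where "L \<theta> = walk_law G (q + scale \<theta> d)" for \<theta>
  define Q where "Q \<theta> s x = exp (- mass G (q + scale \<theta> d)) * conv_exp_deriv G (q + scale \<theta> d) (point s) x" for \<theta> s x
  define \<Psi> where "\<Psi> \<theta> = (\<Sum>x\<in>carrier G. (L \<theta> x - \<beta>) ^ (2 * m))" for \<theta>
  \<comment> \<open>The derivative is grouped by the raised element \<open>s\<close>: the weights
    \<open>d s\<close> are nonnegative and each inner sum turns out to be nonpositive.\<close>
  define D where "D \<theta> = (\<Sum>s\<in>carrier G. d s * (\<Sum>x\<in>carrier G. 2 * real m * (L \<theta> x - \<beta>) ^ (2 * m - 1) * (Q \<theta> s x - L \<theta> x)))" for \<theta>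
  have DL: "((\<lambda>\<theta>. L \<theta> x) has_real_derivative (\<Sum>s\<in>carrier G. d s * (Q \<theta> s x - L \<theta> x))) (at \<theta>)"
    if x: "x \<in> carrier G" for \<theta> x
  proof -
    have "((\<lambda>\<theta>. exp (- (mass G q + \<theta> * mass G d)) * conv_exp G (q + scale \<theta> d) x) has_real_derivative
      exp (- (mass G q + \<theta> * mass G d)) * (- mass G d) * conv_exp G (q + scale \<theta> d) x +
      conv_exp_deriv G (q + scale \<theta> d) d x * exp (- (mass G q + \<theta> * mass G d))) (at \<theta>)"
      by (rule DERIV_mult[OF _ DERIV_conv_exp[OF x]]) (auto intro!: derivative_eq_intros)
    also have "(\<lambda>\<theta>. exp (- (mass G q + \<theta> * mass G d)) * conv_exp G (q + scale \<theta> d) x) = (\<lambda>\<theta>. L \<theta> x)"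
      by (simp add: L_def walk_law_def mass_add mass_scale)
    also have "exp (- (mass G q + \<theta> * mass G d)) * (- mass G d) * conv_exp G (q + scale \<theta> d) x +
        conv_exp_deriv G (q + scale \<theta> d) d x * exp (- (mass G q + \<theta> * mass G d)) =
        (\<Sum>s\<in>carrier G. d s * Q \<theta> s x) - mass G d * L \<theta> x"
      unfolding conv_exp_deriv_eq_sum_points[OF x, of _ d]
      by (simp add: L_def Q_def walk_law_def mass_add mass_scale sum_distrib_left sum_distrib_right mult_ac)
    also have "\<dots> = (\<Sum>s\<in>carrier G. d s * (Q \<theta> s x - L \<theta> x))"
      by (simp add: mass_def sum_distrib_right sum_subtractf right_diff_distrib)
    finally show ?thesis .
  qed
  have D\<Psi>: "(\<Psi> has_real_derivative D \<theta>) (at \<theta>)" for \<theta>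
  proof -
    have "((\<lambda>\<theta>. (L \<theta> x - \<beta>) ^ (2 * m)) has_real_derivative
        2 * real m * (L \<theta> x - \<beta>) ^ (2 * m - 1) * (\<Sum>s\<in>carrier G. d s * (Q \<theta> s x - L \<theta> x))) (at \<theta>)"
      if "x \<in> carrier G" for x
      by (rule DERIV_cong[OF DERIV_power[OF DERIV_diff[OF DL[OF that] DERIV_const]]]) simp
    then have "(\<Psi> has_real_derivative (\<Sum>x\<in>carrier G. 2 * real m * (L \<theta> x - \<beta>) ^ (2 * m - 1) *
        (\<Sum>s\<in>carrier G. d s * (Q \<theta> s x - L \<theta> x)))) (at \<theta>)"
      unfolding \<Psi>_def by (intro DERIV_sum)
    also have "(\<Sum>x\<in>carrier G. 2 * real m * (L \<theta> x - \<beta>) ^ (2 * m - 1) *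
        (\<Sum>s\<in>carrier G. d s * (Q \<theta> s x - L \<theta> x))) = D \<theta>"
      unfolding D_def sum_distrib_left by (subst sum.swap) (simp add: mult_ac)
    finally show ?thesis .
  qed
  have nonpos: "D \<theta> \<le> 0" if \<theta>: "0 \<le> \<theta>" "\<theta> \<le> 1" for \<theta>
  proof -
    have conv: "(r + scale \<theta> d) x = (1 - \<theta>) * r x + \<theta> * r' x" for x
      by (simp add: fun_apply d_def algebra_simps)
    interpret R: lazy_rates G H b "r + scale \<theta> d" k
    proof unfold_locales
      fix x assume x: "x \<in> carrier G"
      have "0 \<le> r' x" using nonneg le x order.trans by blast
      then show "0 \<le> (r + scale \<theta> d) x"
        using \<theta> nonneg x by (simp add: conv)
      show "(r + scale \<theta> d) (inv x) = (r + scale \<theta> d) x"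
        using sym x by (simp add: conv)
    next
      have "mass G (r + scale \<theta> d) \<le> mass G r'"
        unfolding mass_def conv
      proof (rule sum_mono)
        fix x assume "x \<in> carrier G"
        then have "(1 - \<theta>) * r x \<le> (1 - \<theta>) * r' x"
          using \<theta> le by (intro mult_left_mono) auto
        then show "(1 - \<theta>) * r x + \<theta> * r' x \<le> r' x"
          by (simp add: algebra_simps)
      qed
      then show "mass G (r + scale \<theta> d) \<le> k" using lazy by simp
    qed
    have q: "R.q = q + scale \<theta> d"
      by (simp add: R.q_def q_def add_ac)
    have neg: "(\<Sum>x\<in>carrier G. 2 * real m * (L \<theta> x - \<beta>) ^ (2 * m - 1) * (Q \<theta> s x - L \<theta> x)) \<le> 0"
      if s: "s \<in> carrier G" for s
    proof -
      let ?f = "\<lambda>x. L \<theta> x - \<beta>" and ?h = "\<lambda>x. Q \<theta> s x - \<beta>"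
      \<comment> \<open>Since \<open>Q \<theta> s x - L \<theta> x = ?h x - ?f x\<close>, this is
        the tangent inequality at \<open>?f x\<close>.\<close>
      have "2 * real m * ?f x ^ (2 * m - 1) * (Q \<theta> s x - L \<theta> x) \<le> ?h x ^ (2 * m) - ?f x ^ (2 * m)" for x
      proof -
        have "?f x ^ (2 * m - 1) * ?f x = ?f x ^ (2 * m)"
          using m power_Suc2[of "?f x" "2 * m - 1"] by simp
        moreover have "2 * real m * ?f x ^ (2 * m - 1) * (Q \<theta> s x - L \<theta> x) =
            2 * real m * ?f x ^ (2 * m - 1) * ?h x - 2 * real m * (?f x ^ (2 * m - 1) * ?f x)"
          by (simp add: algebra_simps)
        ultimately show ?thesis
          using even_power_Young[OF m, of "?f x" "?h x"] by (simp add: algebra_simps)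
      qed
      then have "(\<Sum>x\<in>carrier G. 2 * real m * ?f x ^ (2 * m - 1) * (Q \<theta> s x - L \<theta> x)) \<le>
          (\<Sum>x\<in>carrier G. ?h x ^ (2 * m) - ?f x ^ (2 * m))"
        by (intro sum_mono)
      also have "\<dots> \<le> 0"
        using R.law_deriv_power_sum[OF s, of m]
        by (simp add: sum_subtractf L_def Q_def q R.law_deriv_def \<beta>_def)
      finally show ?thesis .
    qed
    show ?thesis
      unfolding D_def
    proof (rule sum_nonpos)
      fix s assume "s \<in> carrier G"
      then show "d s * (\<Sum>x\<in>carrier G. 2 * real m * (L \<theta> x - \<beta>) ^ (2 * m - 1) * (Q \<theta> s x - L \<theta> x)) \<le> 0"
        using neg le by (intro mult_nonneg_nonpos) (simp_all add: d_def)
    qed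
  qed
  have "\<Psi> 1 \<le> \<Psi> 0"
    by (rule DERIV_nonpos_imp_nonincreasing) (use D\<Psi> nonpos in auto)
  have eqs: "q + scale 1 d = r' + scale k (point \<one>)" "q + scale 0 d = q"
    by (simp_all add: fun_eq_iff fun_apply q_def d_def)
  show ?thesis
    using \<open>\<Psi> 1 \<le> \<Psi> 0\<close> unfolding \<Psi>_def L_def eqs \<beta>_def unfolding q_def .
qed

end

section \<open>The law of the clock-driven walk\<close>

text \<open>Pascal's rule, in the shape of the induction step of
  \<open>conv_pow_binomial\<close>.\<close>

lemma binomial_shift:
  fixes a c :: real and p :: "nat \<Rightarrow> real"
  shows "(\<Sum>k\<le>Suc n. real (Suc n choose k) * a ^ (Suc n - k) * c ^ k * p k) =
    a * (\<Sum>k\<le>n. real (n choose k) * a ^ (n - k) * c ^ k * p k) +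
    c * (\<Sum>k\<le>n. real (n choose k) * a ^ (n - k) * c ^ k * p (Suc k))"
proof -
  have "a * (\<Sum>k\<le>n. real (n choose k) * a ^ (n - k) * c ^ k * p k) =
      (\<Sum>k\<le>Suc n. real (n choose k) * a ^ (Suc n - k) * c ^ k * p k)"
    by (auto simp: sum_distrib_left Suc_diff_le mult_ac intro!: sum.cong)
  also have "\<dots> = a ^ Suc n * p 0 + (\<Sum>k\<le>n. real (n choose Suc k) * a ^ (n - k) * c ^ Suc k * p (Suc k))"
    by (subst sum.atMost_Suc_shift) simp
  finally show ?thesis
    by (subst sum.atMost_Suc_shift) (simp add: sum.distrib sum_distrib_left algebra_simps)
qed

lemma binomial_over_power_tendsto: "(\<lambda>n. real (n choose k) / real n ^ k) \<longlonglongrightarrow> 1 / fact k"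
proof -
  have "(\<lambda>n. (real n - real i) / real n) \<longlonglongrightarrow> 1" for i
    by real_asymp
  then have "(\<lambda>n. (\<Prod>i=0..<k. (real n - real i) / real n) / fact k) \<longlonglongrightarrow> (\<Prod>i=0..<k. 1) / fact k"
    by (intro tendsto_intros) auto
  moreover have "(\<Prod>i=0..<k. (real n - real i) / real n) / fact k = real (n choose k) / real n ^ k" for n
    by (simp add: binomial_gbinomial gbinomial_prod_rev prod_dividef)
  ultimately show ?thesis by simp
qed

section \<open>Paths with at most one ring per interval\<close>

definition path_lists :: "'b set \<Rightarrow> nat \<Rightarrow> 'b list set" where
  "path_lists S n = {xs. set xs \<subseteq> S \<and> length xs = n}"

lemma finite_path_lists: "finite S \<Longrightarrow> finite (path_lists S n)"
  unfolding path_lists_def by (rule finite_lists_length_eq)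

lemma sum_path_lists_Suc:
  "(\<Sum>xs\<in>path_lists S (Suc n). F xs) = (\<Sum>xs\<in>path_lists S n. \<Sum>a\<in>S. F (xs @ [a]))"
proof -
  have "(\<Sum>xs\<in>path_lists S n. \<Sum>a\<in>S. F (xs @ [a])) = (\<Sum>(xs, a)\<in>path_lists S n \<times> S. F (xs @ [a]))"
    by (rule sum.cartesian_product)
  also have "\<dots> = (\<Sum>xs\<in>path_lists S (Suc n). F xs)"
    by (rule sum.reindex_bij_witness[where j = "\<lambda>(xs, a). xs @ [a]" and i = "\<lambda>xs. (butlast xs, last xs)"])
      (auto simp: path_lists_def length_Suc_conv_rev)
  finally show ?thesis ..
qed

context finite_group
begin

lemma conv_pow_binomial:
  "conv_pow G (scale a (point \<one>) + scale c q) n x =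
    (\<Sum>k\<le>n. real (n choose k) * a ^ (n - k) * c ^ k * conv_pow G q k x)"
proof (induction n arbitrary: x)
  case 0
  then show ?case by simp
next
  case (Suc n)
  have one: "conv_pow G f n \<star> point \<one> = conv_pow G f n" for f n
    by (auto intro!: conv_one_right conv_pow_outside)
  have IH: "conv_pow G (scale a (point \<one>) + scale c q) n =
      (\<Sum>k\<le>n. scale (real (n choose k) * a ^ (n - k) * c ^ k) (conv_pow G q k))"
    by (rule ext) (simp add: Suc sum_fun_apply[of _ _ "_ :: 'g"] scale_apply[of _ _ "_ :: 'g"])
  have "conv_pow G (scale a (point \<one>) + scale c q) (Suc n) x =
      a * conv_pow G (scale a (point \<one>) + scale c q) n x
      + c * (conv_pow G (scale a (point \<one>) + scale c q) n \<star> q) x"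
    by (simp add: conv_add_right conv_scale_right one plus_fun_apply[of _ _ x] scale_apply[of _ _ x])
  also have "(conv_pow G (scale a (point \<one>) + scale c q) n \<star> q) x =
      (\<Sum>k\<le>n. real (n choose k) * a ^ (n - k) * c ^ k * conv_pow G q (Suc k) x)"
    unfolding IH conv_sum_left conv_scale_left sum_fun_apply[of _ _ x] scale_apply[of _ _ x] by simp
  finally show ?case
    unfolding binomial_shift Suc .
qed

text \<open>\<open>None\<close> stands for an interval in which no clock rings.\<close>

definition jump :: "'g \<Rightarrow> 'g option \<Rightarrow> 'g" where
  "jump x s = (case s of None \<Rightarrow> x | Some s \<Rightarrow> x \<otimes> s)"

text \<open>The probability that within time \<open>h\<close> the clock of \<open>s\<close> rings
  once and all others are silent, or that all are silent; the exponential collects the contributions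
  of all clocks.\<close>

definition jump_weight :: "('g \<Rightarrow> real) \<Rightarrow> real \<Rightarrow> 'g option \<Rightarrow> real" where
  "jump_weight q h s = (case s of None \<Rightarrow> 1 | Some s \<Rightarrow> h * q s) * exp (- (h * mass G q))"

abbreviation jumps where "jumps \<equiv> insert None (Some ` carrier G)"

lemma endpoint_closed: "set xs \<subseteq> jumps \<Longrightarrow> x \<in> carrier G \<Longrightarrow> foldl jump x xs \<in> carrier G"
  by (induction xs arbitrary: x) (auto simp: jump_def)

lemma sum_jumps: "(\<Sum>s\<in>jumps. f s) = f None + (\<Sum>s\<in>carrier G. f (Some s))"
  by (subst sum.insert) (auto simp: sum.reindex)

text \<open>Each interval contributes a convolution with \<open>point \<one> + scale h q\<close> and
  one exponential factor.\<close>

lemma sum_jump_paths: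
  assumes "x \<in> carrier G"
  shows "(\<Sum>xs\<in>path_lists jumps n. if foldl jump \<one> xs = x then prod_list (map (jump_weight q h) xs) else 0) =
    exp (- (real n * (h * mass G q))) * conv_pow G (point \<one> + scale h q) n x"
  using assms
proof (induction n arbitrary: x)
  case 0
  have "path_lists jumps 0 = {[]}" by (auto simp: path_lists_def)
  then show ?case by (auto simp: point_def)
next
  case (Suc n)
  let ?W = "\<lambda>xs. prod_list (map (jump_weight q h) xs)"
  let ?T = "\<lambda>x. \<Sum>xs\<in>path_lists jumps n. if foldl jump \<one> xs = x then ?W xs else 0"
  let ?e = "exp (- (h * mass G q))"
  let ?P = "conv_pow G (point \<one> + scale h q) n"
  have "(\<Sum>xs\<in>path_lists jumps (Suc n). if foldl jump \<one> xs = x then ?W xs else 0) =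
      (\<Sum>xs\<in>path_lists jumps n. \<Sum>s\<in>jumps. if jump (foldl jump \<one> xs) s = x then ?W xs * jump_weight q h s else 0)"
    unfolding sum_path_lists_Suc by (intro sum.cong HOL.refl) (simp cong: if_cong)
  also have "\<dots> = (\<Sum>xs\<in>path_lists jumps n. ?e * (if foldl jump \<one> xs = x then ?W xs else 0) +
      (\<Sum>s\<in>carrier G. ?e * (h * q s) * (if foldl jump \<one> xs = x \<otimes> inv s then ?W xs else 0)))"
  proof (intro sum.cong HOL.refl)
    fix xs assume "xs \<in> path_lists jumps n"
    then have c: "foldl jump \<one> xs \<in> carrier G"
      by (intro endpoint_closed) (auto simp: path_lists_def)
    have iff: "foldl jump \<one> xs \<otimes> s = x \<longleftrightarrow> foldl jump \<one> xs = x \<otimes> inv s" if "s \<in> carrier G" for s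
      using c that Suc.prems inv_solve_right[of x s "foldl jump \<one> xs"] by (auto simp: inv_solve_right m_assoc)
    show "(\<Sum>s\<in>jumps. if jump (foldl jump \<one> xs) s = x then ?W xs * jump_weight q h s else 0) =
        ?e * (if foldl jump \<one> xs = x then ?W xs else 0) +
        (\<Sum>s\<in>carrier G. ?e * (h * q s) * (if foldl jump \<one> xs = x \<otimes> inv s then ?W xs else 0))"
      unfolding sum_jumps
      by (intro arg_cong2[where f = "(+)"] sum.cong HOL.refl) (simp_all add: jump_def jump_weight_def iff)
  qed
  also have "\<dots> = ?e * ?T x + (\<Sum>s\<in>carrier G. ?e * (h * q s) * ?T (x \<otimes> inv s))"
    unfolding sum.distrib sum_distrib_left by (subst (2) sum.swap) simp
  also have "\<dots> = ?e * exp (- (real n * (h * mass G q))) * (?P x + h * (\<Sum>s\<in>carrier G. q s * ?P (x \<otimes> inv s)))"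
    using Suc.prems by (simp add: Suc.IH sum_distrib_left algebra_simps)
  also have "?e * exp (- (real n * (h * mass G q))) = exp (- (real (Suc n) * (h * mass G q)))"
    by (simp add: exp_add[symmetric] algebra_simps)
  also have "(\<Sum>s\<in>carrier G. q s * ?P (x \<otimes> inv s)) = (?P \<star> q) x"
    using Suc.prems unfolding conv_eq_sum_points[of ?P q]
    by (simp add: sum_fun_apply[of _ _ x] scale_apply[of _ _ x] conv_point_right)
  also have "?P x + h * (?P \<star> q) x = conv_pow G (point \<one> + scale h q) (Suc n) x"
  proof -
    have "?P \<star> point \<one> = ?P"
      by (intro conv_one_right conv_pow_outside)
    then show ?thesis
      by (simp add: conv_add_right conv_scale_right plus_fun_apply[of _ _ x] scale_apply[of _ _ x])
  qed
  finally show ?case .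
qed

end

section \<open>Probabilities of ring patterns\<close>

lemma measurable_diff_nat:
  assumes "f \<in> measurable M (count_space UNIV)" "g \<in> measurable M (count_space UNIV)"
  shows "(\<lambda>x. f x - g x :: nat) \<in> measurable M (count_space UNIV)"
  by (rule measurable_compose_countable[OF _ assms(2)], rule measurable_compose[OF assms(1)]) simp

lemma sets_diff_nat_eq:
  fixes c :: nat
  assumes "f \<in> measurable M (count_space UNIV)" "g \<in> measurable M (count_space UNIV)"
  shows "{x \<in> space M. f x - g x = c} \<in> sets M"
proof -
  have "{x \<in> space M. f x - g x = c} = (\<lambda>x. f x - g x) -` {c} \<inter> space M"
    by auto
  then show ?thesis
    using measurable_sets[OF measurable_diff_nat[OF assms], of "{c}"] by (simp only: space_count_space sets_count_space Pow_UNIV UNIV_I)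
qed

lemma (in poisson_clock) prob_increments:
  assumes "0 \<le> h" "0 < n"
  shows "prob {\<omega> \<in> space M. \<forall>i<n. N (real (Suc i) * h) \<omega> - N (real i * h) \<omega> = c i} =
    (\<Prod>i<n. (rate * h) ^ c i / fact (c i) * exp (- (rate * h)))"
proof -
  define \<tau> where "\<tau> i = real i * h" for i
  have "mono \<tau>" "0 \<le> \<tau> 0"
    using assms by (auto simp: \<tau>_def mono_def intro!: mult_right_mono)
  then have "indep_vars (\<lambda>_. count_space UNIV) (\<lambda>i \<omega>. N (\<tau> (Suc i)) \<omega> - N (\<tau> i) \<omega>) {..<n}"
    by (rule independent_increments)
  then have "prob (\<Inter>i\<in>{..<n}. (\<lambda>\<omega>. N (\<tau> (Suc i)) \<omega> - N (\<tau> i) \<omega>) -` {c i} \<inter> space M) =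
      (\<Prod>i\<in>{..<n}. prob ((\<lambda>\<omega>. N (\<tau> (Suc i)) \<omega> - N (\<tau> i) \<omega>) -` {c i} \<inter> space M))"
    by (rule indep_varsD) (use assms in auto)
  also have "(\<Inter>i\<in>{..<n}. (\<lambda>\<omega>. N (\<tau> (Suc i)) \<omega> - N (\<tau> i) \<omega>) -` {c i} \<inter> space M) =
      {\<omega> \<in> space M. \<forall>i<n. N (real (Suc i) * h) \<omega> - N (real i * h) \<omega> = c i}"
    using assms by (auto simp: \<tau>_def)
  also have "(\<Prod>i\<in>{..<n}. prob ((\<lambda>\<omega>. N (\<tau> (Suc i)) \<omega> - N (\<tau> i) \<omega>) -` {c i} \<inter> space M)) =
      (\<Prod>i<n. (rate * h) ^ c i / fact (c i) * exp (- (rate * h)))"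
  proof (intro prod.cong HOL.refl)
    fix i
    have "0 \<le> \<tau> i" "\<tau> i \<le> \<tau> (Suc i)" "\<tau> (Suc i) - \<tau> i = h"
      using assms by (auto simp: \<tau>_def algebra_simps)
    moreover have "(\<lambda>\<omega>. N (\<tau> (Suc i)) \<omega> - N (\<tau> i) \<omega>) -` {c i} \<inter> space M =
        {\<omega> \<in> space M. N (\<tau> (Suc i)) \<omega> - N (\<tau> i) \<omega> = c i}"
      by auto
    ultimately show "prob ((\<lambda>\<omega>. N (\<tau> (Suc i)) \<omega> - N (\<tau> i) \<omega>) -` {c i} \<inter> space M) =
        (rate * h) ^ c i / fact (c i) * exp (- (rate * h))"
      using poisson_increments[of "\<tau> i" "\<tau> (Suc i)" "c i"] by simp
  qed
  finally show ?thesis .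
qed

locale finite_group_walk = clock_driven_walk M G q N X + finite_group G
  for M :: "'w measure" and G :: "('g, 'm) monoid_scheme" (structure) and q N X
begin

definition path_event :: "real \<Rightarrow> 'g option list \<Rightarrow> 'w set" where
  "path_event h xs = {\<omega> \<in> space M. \<forall>s\<in>carrier G. \<forall>i<length xs.
    N s (real (Suc i) * h) \<omega> - N s (real i * h) \<omega> = (if xs ! i = Some s then 1 else 0)}"

lemma count_space_measurable: "s \<in> carrier G \<Longrightarrow> 0 \<le> t \<Longrightarrow> N s t \<in> measurable M (count_space UNIV)"
  by (rule poisson_clock.count_measurable[OF clocks])

lemma path_event_sets:
  assumes "0 \<le> h" shows "path_event h xs \<in> sets M"
  unfolding path_event_def
proof (rule sets.sets_Collect_finite_All[OF _ finite_carrier])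
  fix s assume s: "s \<in> carrier G"
  have "0 \<le> real i * h" for i
    using assms by simp
  note meas = count_space_measurable[OF s this]
  have "{\<omega> \<in> space M. \<forall>i<length xs. N s (real (Suc i) * h) \<omega> - N s (real i * h) \<omega> =
      (if xs ! i = Some s then 1 else 0)} = {\<omega> \<in> space M. \<forall>i\<in>{..<length xs}.
      N s (real (Suc i) * h) \<omega> - N s (real i * h) \<omega> = (if xs ! i = Some s then 1 else 0)}"
    unfolding Ball_def lessThan_iff ..
  also have "\<dots> \<in> sets M"
    by (rule sets.sets_Collect_finite_All[OF sets_diff_nat_eq[OF meas meas] finite_lessThan])
  finally show "{\<omega> \<in> space M. \<forall>i<length xs. N s (real (Suc i) * h) \<omega> - N s (real i * h) \<omega> =
      (if xs ! i = Some s then 1 else 0)} \<in> sets M" .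
qed

text \<open>Independence enters twice: between the clocks, and between the increments of one clock.
  Exchanging the products over clocks and intervals leaves one \<open>jump_weight\<close> per
  interval.\<close>

lemma prob_path_event:
  assumes h: "0 \<le> h" and xs: "set xs \<subseteq> jumps" "xs \<noteq> []"
  shows "prob (path_event h xs) = prod_list (map (jump_weight q h) xs)"
proof -
  let ?n = "length xs"
  let ?c = "\<lambda>s i. if xs ! i = Some s then 1 else 0 :: nat"
  let ?P = "\<Pi>\<^sub>M t\<in>{0::real..}. count_space (UNIV :: nat set)"
  \<comment> \<open>The ring pattern of one clock as an event on its whole trajectory, the form to
    which \<open>independent_clocks\<close> applies.\<close>
  define E where "E s = {f \<in> space ?P. \<forall>i<?n. f (real (Suc i) * h) - f (real i * h) = ?c s i}" for s
  have E: "E s \<in> sets ?P" for s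
  proof -
    have "real i * h \<in> {0..}" for i
      using h by simp
    then have meas: "(\<lambda>f. f (real i * h)) \<in> measurable ?P (count_space UNIV)" for i
      by (rule measurable_component_singleton)
    have "E s = {f \<in> space ?P. \<forall>i\<in>{..<?n}. f (real (Suc i) * h) - f (real i * h) = ?c s i}"
      unfolding E_def Ball_def lessThan_iff ..
    also have "\<dots> \<in> sets ?P"
      by (rule sets.sets_Collect_finite_All[OF sets_diff_nat_eq[OF meas meas] finite_lessThan])
    finally show ?thesis .
  qed
  let ?Y = "\<lambda>s \<omega>. \<lambda>t\<in>{0..}. N s t \<omega>"
  have pre: "?Y s -` E s \<inter> space M =
      {\<omega> \<in> space M. \<forall>i<?n. N s (real (Suc i) * h) \<omega> - N s (real i * h) \<omega> = ?c s i}" for s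
    using h by (auto simp: E_def space_PiM)
  have "prob (\<Inter>s\<in>carrier G. ?Y s -` E s \<inter> space M) = (\<Prod>s\<in>carrier G. prob (?Y s -` E s \<inter> space M))"
  proof (rule indep_varsD[OF independent_clocks])
    show "carrier G \<noteq> {}" using one_closed by blast
    show "E s \<in> sets ?P" for s by (rule E)
  qed (rule finite_carrier, rule subset_refl)
  also have "(\<Inter>s\<in>carrier G. ?Y s -` E s \<inter> space M) = path_event h xs"
    unfolding pre path_event_def by auto
  also have "(\<Prod>s\<in>carrier G. prob (?Y s -` E s \<inter> space M)) =
      (\<Prod>s\<in>carrier G. \<Prod>i<?n. (q s * h) ^ ?c s i / fact (?c s i) * exp (- (q s * h)))"
    unfolding pre using h xs(2)
    by (intro prod.cong HOL.refl poisson_clock.prob_increments[OF clocks]) auto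
  also have "\<dots> = (\<Prod>i<?n. \<Prod>s\<in>carrier G. (q s * h) ^ ?c s i / fact (?c s i) * exp (- (q s * h)))"
    by (rule prod.swap)
  also have "\<dots> = (\<Prod>i<?n. jump_weight q h (xs ! i))"
  proof (intro prod.cong HOL.refl)
    fix i assume "i \<in> {..<?n}"
    then have i: "xs ! i \<in> jumps"
      using xs nth_mem by blast
    have "(\<Prod>s\<in>carrier G. (q s * h) ^ ?c s i / fact (?c s i) * exp (- (q s * h))) =
        (\<Prod>s\<in>carrier G. if xs ! i = Some s then q s * h else 1) * (\<Prod>s\<in>carrier G. exp (- (q s * h)))"
      unfolding prod.distrib[symmetric] by (intro prod.cong HOL.refl) simp
    also have "(\<Prod>s\<in>carrier G. exp (- (q s * h))) = exp (- (h * mass G q))"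
      by (simp add: exp_sum[symmetric] mass_def sum_distrib_left sum_negf mult.commute)
    also have "(\<Prod>s\<in>carrier G. if xs ! i = Some s then q s * h else 1) * exp (- (h * mass G q)) =
        jump_weight q h (xs ! i)"
      using i by (auto simp: jump_weight_def mult.commute prod.delta)
    finally show "(\<Prod>s\<in>carrier G. (q s * h) ^ ?c s i / fact (?c s i) * exp (- (q s * h))) =
        jump_weight q h (xs ! i)" .
  qed
  also have "\<dots> = prod_list (map (jump_weight q h) xs)"
    by (simp add: prod.list_conv_set_nth atLeast0LessThan)
  finally show ?thesis .
qed

lemma path_eventD:
  assumes "\<omega> \<in> path_event h xs" "s \<in> carrier G" "i < length xs"
  shows "N s (real (Suc i) * h) \<omega> - N s (real i * h) \<omega> = (if xs ! i = Some s then 1 else 0)"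
proof -
  have "\<forall>s\<in>carrier G. \<forall>i<length xs.
      N s (real (Suc i) * h) \<omega> - N s (real i * h) \<omega> = (if xs ! i = Some s then 1 else 0)"
    using assms(1) unfolding path_event_def mem_Collect_eq by (rule conjunct2)
  then show ?thesis
    using assms(2,3) by (simp only:)
qed

lemma jumps_eqI:
  assumes "a \<in> jumps" "c \<in> jumps" "\<And>s. s \<in> carrier G \<Longrightarrow> a = Some s \<longleftrightarrow> c = Some s"
  shows "a = c"
proof (cases a)
  case None
  then show ?thesis
    using assms(2,3) by (cases c) auto
next
  case (Some s)
  then have "s \<in> carrier G" using assms(1) by auto
  then show ?thesis
    using assms(3)[of s] Some by simp
qed

lemma path_event_disjoint:
  assumes xs: "xs \<in> path_lists jumps n" and ys: "ys \<in> path_lists jumps n" and "xs \<noteq> ys"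
  shows "path_event h xs \<inter> path_event h ys = {}"
proof (rule ccontr)
  assume "path_event h xs \<inter> path_event h ys \<noteq> {}"
  then obtain \<omega> where \<omega>: "\<omega> \<in> path_event h xs" "\<omega> \<in> path_event h ys" by blast
  have len: "length xs = n" "length ys = n" and sub: "set xs \<subseteq> jumps" "set ys \<subseteq> jumps"
    using xs ys unfolding path_lists_def by simp_all
  have "xs ! i = ys ! i" if i: "i < length xs" for i
  proof (rule jumps_eqI)
    show "xs ! i \<in> jumps"
      by (rule subsetD[OF sub(1) nth_mem[OF i]])
    show "ys ! i \<in> jumps"
      by (rule subsetD[OF sub(2) nth_mem]) (use i len in simp)
    fix s assume s: "s \<in> carrier G"
    have "(if xs ! i = Some s then 1 else 0 :: nat) = (if ys ! i = Some s then 1 else 0)"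
      using path_eventD[OF \<omega>(1) s, of i] path_eventD[OF \<omega>(2) s, of i] i len by simp
    then show "xs ! i = Some s \<longleftrightarrow> ys ! i = Some s"
      by (cases "xs ! i = Some s"; cases "ys ! i = Some s") simp_all
  qed
  then have "xs = ys"
    using len by (intro nth_equalityI) simp_all
  then show False
    using assms(3) by simp
qed

text \<open>On each interval \<open>walk_rest\<close> or \<open>walk_ring\<close> applies; monotone
  counts turn the truncated differences into exact equations.\<close>

lemma AE_path_event:
  assumes h: "0 \<le> h" and xs: "set xs \<subseteq> jumps"
  shows "AE \<omega> in M. \<omega> \<in> path_event h xs \<longrightarrow> X (real (length xs) * h) \<omega> = foldl jump \<one> xs"
proof -
  have "AE \<omega> in M. \<forall>s\<in>carrier G. mono_on {0..} (\<lambda>t. N s t \<omega>)"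
    by (rule AE_finite_allI[OF finite_carrier]) (rule poisson_clock.count_mono[OF clocks])
  with walk_0 walk_rest walk_ring show ?thesis
  proof eventually_elim
    case (elim \<omega>)
    show ?case
    proof
      assume \<omega>: "\<omega> \<in> path_event h xs"
      have "X (real i * h) \<omega> = foldl jump \<one> (take i xs)" if "i \<le> length xs" for i
        using that
      proof (induction i)
        case 0
        then show ?case using elim(1) by simp
      next
        case (Suc i)
        let ?a = "real i * h" and ?b = "real (Suc i) * h"
        have ab: "0 \<le> ?a" "?a \<le> ?b"
          using h by (auto intro!: mult_right_mono)
        have N: "N s ?b \<omega> = N s ?a \<omega> + (if xs ! i = Some s then 1 else 0)" if "s \<in> carrier G" for s
        proof -
          have "N s ?a \<omega> \<le> N s ?b \<omega>"
            using mono_onD[OF bspec[OF elim(4) that], of ?a ?b] ab by simp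
          moreover have "N s ?b \<omega> - N s ?a \<omega> = (if xs ! i = Some s then 1 else 0)"
            using path_eventD[OF \<omega> that, of i] Suc.prems by simp
          ultimately show ?thesis by linarith
        qed
        have "X ?b \<omega> = jump (X ?a \<omega>) (xs ! i)"
        proof (cases "xs ! i")
          case None
          then show ?thesis
            using elim(2)[THEN spec, THEN spec, THEN mp, THEN mp, THEN mp, OF ab] N by (simp add: jump_def)
        next
          case (Some s)
          have "xs ! i \<in> jumps"
            by (rule subsetD[OF xs nth_mem]) (use Suc.prems in simp)
          then have s: "s \<in> carrier G"
            using Some by auto
          have "N s ?b \<omega> = Suc (N s ?a \<omega>)" "\<forall>r\<in>carrier G - {s}. N r ?b \<omega> = N r ?a \<omega>"
            using N s Some by auto
          then have "X ?b \<omega> = X ?a \<omega> \<otimes> s"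
            using elim(3)[THEN spec, THEN spec, THEN bspec, THEN mp, THEN mp, THEN mp, THEN mp, OF s ab] by simp
          then show ?thesis
            using Some by (simp add: jump_def)
        qed
        then show ?case
          using Suc by (simp add: take_Suc_conv_app_nth)
      qed
      from this[of "length xs"] show "X (real (length xs) * h) \<omega> = foldl jump \<one> xs"
        by simp
    qed
  qed
qed

lemma walk_prob_sets: "0 \<le> t \<Longrightarrow> {\<omega> \<in> space M. X t \<omega> = x} \<in> sets M"
proof -
  assume t: "0 \<le> t"
  have "{\<omega> \<in> space M. X t \<omega> = x} = X t -` ({x} \<inter> carrier G) \<inter> space M"
    using measurable_space[OF walk_measurable[OF t]] by auto
  also have "\<dots> \<in> sets M"
    by (rule measurable_sets[OF walk_measurable[OF t]]) simp
  finally show ?thesis .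
qed

text \<open>The patterns leading to \<open>x\<close> are disjoint events; those with several rings
  in one interval are left out, hence an inequality.\<close>

lemma walk_prob_ge_conv_pow:
  assumes t: "0 \<le> t" and n: "0 < n" and x: "x \<in> carrier G"
  shows "exp (- (t * mass G q)) * conv_pow G (point \<one> + scale (t / real n) q) n x \<le> walk_prob M X t x"
proof -
  define h where "h = t / real n"
  have h: "0 \<le> h" "real n * h = t" using t n by (auto simp: h_def)
  define L where "L = {xs \<in> path_lists jumps n. foldl jump \<one> xs = x}"
  have fin: "finite L" "finite (path_lists jumps n)"
    unfolding L_def by (simp_all add: finite_path_lists)
  have "exp (- (t * mass G q)) * conv_pow G (point \<one> + scale h q) n x =
      (\<Sum>xs\<in>path_lists jumps n. if foldl jump \<one> xs = x then prod_list (map (jump_weight q h) xs) else 0)"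
    using sum_jump_paths[OF x, of q h n] h(2) by (simp add: mult.assoc[symmetric])
  also have "\<dots> = (\<Sum>xs\<in>L. prod_list (map (jump_weight q h) xs))"
    unfolding L_def using fin by (subst sum.inter_filter[symmetric]) auto
  also have "\<dots> = (\<Sum>xs\<in>L. prob (path_event h xs))"
    using n h by (intro sum.cong HOL.refl prob_path_event[symmetric]) (auto simp: L_def path_lists_def)
  also have "\<dots> = prob (\<Union>xs\<in>L. path_event h xs)"
  proof (rule finite_measure_finite_Union[symmetric, OF fin(1)])
    show "path_event h ` L \<subseteq> sets M"
      using path_event_sets[OF h(1)] by blast
    show "disjoint_family_on (path_event h) L"
      using path_event_disjoint unfolding disjoint_family_on_def L_def by blast
  qed
  also have "\<dots> \<le> prob {\<omega> \<in> space M. X t \<omega> = x}"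
  proof (rule finite_measure_mono_AE)
    have "AE \<omega> in M. \<forall>xs\<in>L. \<omega> \<in> path_event h xs \<longrightarrow> X (real (length xs) * h) \<omega> = foldl jump \<one> xs"
    proof (rule AE_finite_allI[OF fin(1)])
      fix xs assume "xs \<in> L"
      then have "set xs \<subseteq> jumps" by (simp add: L_def path_lists_def)
      then show "AE \<omega> in M. \<omega> \<in> path_event h xs \<longrightarrow> X (real (length xs) * h) \<omega> = foldl jump \<one> xs"
        by (rule AE_path_event[OF h(1)])
    qed
    then show "AE \<omega> in M. \<omega> \<in> (\<Union>xs\<in>L. path_event h xs) \<longrightarrow> \<omega> \<in> {\<omega> \<in> space M. X t \<omega> = x}"
      by eventually_elim (use h(2) in \<open>auto simp: L_def path_lists_def path_event_def\<close>)
  qed (rule walk_prob_sets[OF t])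
  finally show ?thesis
    by (simp add: walk_prob_def h_def)
qed

lemma walk_prob_eq:
  assumes t: "0 \<le> t" and k: "0 \<le> k" and x: "x \<in> carrier G"
    and nonneg: "\<And>s. s \<in> carrier G \<Longrightarrow> 0 \<le> q s"
  shows "walk_prob M X t x = walk_law G (scale t q + scale k (point \<one>)) x"
proof -
  define Q where "Q = scale t q + scale k (point \<one>)"
  have massQ: "mass G Q = t * mass G q + k"
    by (simp add: Q_def mass_add mass_scale mass_point)
  have Q_nonneg: "0 \<le> Q s" if "s \<in> carrier G" for s
    using t k nonneg[OF that] by (simp add: Q_def fun_apply point_def)
  have pow_nonneg: "0 \<le> conv_pow G Q j y" for j y
  proof (induction j arbitrary: y)
    case (Suc j)
    then show ?case
      using Q_nonneg by (cases "y \<in> carrier G") (auto simp: conv_eq conv_outside intro!: sum_nonneg mult_nonneg_nonneg)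
  qed (simp add: point_def)
  have ge: "walk_law G Q y \<le> walk_prob M X t y" if y: "y \<in> carrier G" for y
  proof -
    \<comment> \<open>Only \<open>K\<close> terms of the binomial expansion are kept, so that the
      limit in \<open>n\<close> concerns a finite sum; \<open>K\<close> tends to infinity
      afterwards.\<close>
    have bound: "exp (- (t * mass G q)) * exp (- k) * (\<Sum>j<K. conv_pow G Q j y / fact j) \<le> walk_prob M X t y" for K
    proof (rule LIMSEQ_le_const2)
      have "(\<lambda>n. exp (- (t * mass G q)) * (1 + (- k) / real n) ^ n *
          (\<Sum>j<K. conv_pow G Q j y * (real (n choose j) / real n ^ j)))
          \<longlonglongrightarrow> exp (- (t * mass G q)) * exp (- k) * (\<Sum>j<K. conv_pow G Q j y * (1 / fact j))"
        by (intro tendsto_mult tendsto_const tendsto_exp_limit_sequentially tendsto_sum binomial_over_power_tendsto)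
      then show "(\<lambda>n. exp (- (t * mass G q)) * (1 + (- k) / real n) ^ n *
          (\<Sum>j<K. conv_pow G Q j y * (real (n choose j) / real n ^ j)))
          \<longlonglongrightarrow> exp (- (t * mass G q)) * exp (- k) * (\<Sum>j<K. conv_pow G Q j y / fact j)"
        by simp
      show "\<exists>m. \<forall>n\<ge>m. exp (- (t * mass G q)) * (1 + (- k) / real n) ^ n *
          (\<Sum>j<K. conv_pow G Q j y * (real (n choose j) / real n ^ j)) \<le> walk_prob M X t y"
      proof (intro exI allI impI)
        fix n assume n: "max (Suc K) (nat \<lceil>k\<rceil>) \<le> n"
        then have n0: "0 < n" "K < n" and kn: "k \<le> real n" by linarith+
        \<comment> \<open>Each step gives up the part \<open>k / real n\<close> of its idle weight
          to \<open>Q\<close>. The factor \<open>a ^ n\<close> tends to \<open>exp (- k)\<close>,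
          the normalisation belonging to the extra rate of the identity.\<close>
        define a where "a = 1 + (- k) / real n"
        have a: "0 \<le> a" "a \<le> 1"
          using kn k n0 by (auto simp: a_def field_simps)
        have Qa: "point \<one> + scale (t / real n) q = scale a (point \<one>) + scale (1 / real n) Q"
          using n0 by (simp add: fun_eq_iff fun_apply Q_def a_def field_simps)
        have "a ^ n * (\<Sum>j<K. conv_pow G Q j y * (real (n choose j) / real n ^ j)) =
            (\<Sum>j<K. real (n choose j) * a ^ n * (1 / real n) ^ j * conv_pow G Q j y)"
          by (simp add: sum_distrib_left power_divide mult_ac)
        also have "\<dots> \<le> (\<Sum>j<K. real (n choose j) * a ^ (n - j) * (1 / real n) ^ j * conv_pow G Q j y)"
          using a by (intro sum_mono mult_right_mono mult_left_mono power_decreasing pow_nonneg) auto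
        also have "\<dots> \<le> (\<Sum>j\<le>n. real (n choose j) * a ^ (n - j) * (1 / real n) ^ j * conv_pow G Q j y)"
          using a n0 by (intro sum_mono2 mult_nonneg_nonneg pow_nonneg) auto
        also have "\<dots> = conv_pow G (point \<one> + scale (t / real n) q) n y"
          unfolding Qa conv_pow_binomial ..
        finally have "exp (- (t * mass G q)) * (a ^ n * (\<Sum>j<K. conv_pow G Q j y * (real (n choose j) / real n ^ j)))
            \<le> exp (- (t * mass G q)) * conv_pow G (point \<one> + scale (t / real n) q) n y"
          by (intro mult_left_mono) auto
        also have "\<dots> \<le> walk_prob M X t y"
          by (rule walk_prob_ge_conv_pow[OF t n0(1) y])
        finally show "exp (- (t * mass G q)) * (1 + (- k) / real n) ^ n *
          (\<Sum>j<K. conv_pow G Q j y * (real (n choose j) / real n ^ j)) \<le> walk_prob M X t y"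
          by (simp add: a_def mult.assoc)
      qed
    qed
    have lim: "(\<lambda>K. exp (- (t * mass G q)) * exp (- k) * (\<Sum>j<K. conv_pow G Q j y / fact j))
        \<longlonglongrightarrow> exp (- (t * mass G q)) * exp (- k) * conv_exp G Q y"
      using conv_exp_sums[OF y, of Q] unfolding sums_def by (intro tendsto_intros)
    have "exp (- (t * mass G q)) * exp (- k) * conv_exp G Q y \<le> walk_prob M X t y"
      by (rule LIMSEQ_le_const2[OF lim]) (use bound in blast)
    then show ?thesis
      by (simp add: walk_law_def massQ exp_add[symmetric])
  qed
  have "(\<Sum>y\<in>carrier G. walk_law G Q y) = 1"
    using mass_conv_exp[of Q] by (simp add: walk_law_def sum_distrib_left[symmetric] mass_def exp_minus)
  moreover have "(\<Sum>y\<in>carrier G. walk_prob M X t y) = 1"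
  proof -
    have "(\<Sum>y\<in>carrier G. walk_prob M X t y) = prob (\<Union>y\<in>carrier G. {\<omega> \<in> space M. X t \<omega> = y})"
      unfolding walk_prob_def
    proof (rule finite_measure_finite_Union[symmetric, OF finite_carrier])
      show "(\<lambda>y. {\<omega> \<in> space M. X t \<omega> = y}) ` carrier G \<subseteq> sets M"
        using walk_prob_sets[OF t] by blast
      show "disjoint_family_on (\<lambda>y. {\<omega> \<in> space M. X t \<omega> = y}) (carrier G)"
        unfolding disjoint_family_on_def by blast
    qed
    also have "(\<Union>y\<in>carrier G. {\<omega> \<in> space M. X t \<omega> = y}) = space M"
      using measurable_space[OF walk_measurable[OF t]] by auto
    finally show ?thesis by (simp add: prob_space)
  qed
  ultimately have "(\<Sum>y\<in>carrier G. walk_prob M X t y - walk_law G Q y) = 0"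
    by (simp add: sum_subtractf)
  then have "walk_prob M X t x - walk_law G Q x = 0"
    using sum_nonneg_eq_0_iff[of "carrier G" "\<lambda>y. walk_prob M X t y - walk_law G Q y"] ge x by auto
  then show ?thesis
    by (simp add: Q_def)
qed

end

section \<open>Normal forms in the inversion extension\<close>

locale inversion_presentation = comm_group A for A :: "('a, 'm) monoid_scheme" (structure) +
  fixes z :: 'a
  assumes finite_A: "finite (carrier A)"
    and z_closed: "z \<in> carrier A"
    and z_square: "z \<otimes> z = \<one>"
begin

abbreviation E where "E \<equiv> inversion_extension A z"
abbreviation cls where "cls w \<equiv> word_rel (ext_generators A) (ext_relations A z) `` {w}"
abbreviation words where "words \<equiv> words_over (ext_generators A)"

definition elem :: "'a \<Rightarrow> 'a ext_gen word set" where
  "elem a = cls [(Elem a, True)]"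

definition ext :: "'a ext_gen word set" where
  "ext = cls [(Ext, True)]"

sublocale E: group E
  unfolding inversion_extension_def by (rule group_presented_group)

lemma letter_word [simp]:
  "a \<in> carrier A \<Longrightarrow> [(Elem a, i)] \<in> words" "[(Ext, i)] \<in> words" "[] \<in> words"
  by (auto simp: words_over_def ext_generators_def)

lemma append_word: "v \<in> words \<Longrightarrow> w \<in> words \<Longrightarrow> v @ w \<in> words"
  by (simp add: words_over_def)

lemma carrier_E: "carrier E = cls ` words"
  by (auto simp: inversion_extension_def presented_group_def quotient_def)

lemma cls_closed [simp]: "w \<in> words \<Longrightarrow> cls w \<in> carrier E"
  by (simp add: carrier_E)

lemma mult_cls: "v \<in> words \<Longrightarrow> w \<in> words \<Longrightarrow> cls v \<otimes>\<^bsub>E\<^esub> cls w = cls (v @ w)"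
  unfolding inversion_extension_def by (rule presented_group_mult)

lemma one_cls: "\<one>\<^bsub>E\<^esub> = cls []"
  by (simp add: inversion_extension_def presented_group_def)

lemma cls_eqI: "(v, w) \<in> word_rel (ext_generators A) (ext_relations A z) \<Longrightarrow> cls v = cls w"
  by (rule equiv_class_eq[OF equiv_word_rel])

lemma cls_relation: "(v, w) \<in> ext_relations A z \<Longrightarrow> v \<in> words \<Longrightarrow> w \<in> words \<Longrightarrow> cls v = cls w"
  by (intro cls_eqI word_rel.relation)

lemma elem_closed [simp]: "a \<in> carrier A \<Longrightarrow> elem a \<in> carrier E"
  by (simp add: elem_def)

lemma ext_closed [simp]: "ext \<in> carrier E"
  by (simp add: ext_def)

lemma elem_mult:
  assumes "a \<in> carrier A" "c \<in> carrier A"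
  shows "elem a \<otimes>\<^bsub>E\<^esub> elem c = elem (a \<otimes> c)"
proof -
  have "cls [(Elem a, True), (Elem c, True)] = cls [(Elem (a \<otimes> c), True)]"
    using assms by (intro cls_relation) (auto simp: ext_relations_def words_over_def ext_generators_def)
  then show ?thesis
    using assms by (simp add: elem_def mult_cls)
qed

sublocale elem: group_hom A E elem
  by unfold_locales (auto simp: hom_def elem_mult)

declare elem.hom_mult [simp del] elem.hom_inv [simp del]

lemma inv_letter: "x \<in> ext_generators A \<Longrightarrow> cls [(x, False)] = inv\<^bsub>E\<^esub> cls [(x, True)]"
proof -
  assume x: "x \<in> ext_generators A"
  have w: "[(x, i)] \<in> words" for i
    using x by (simp add: words_over_def)
  have "cls [(x, False), (x, True)] = cls []"
    using word_rel.cancel[OF x, of False] by (intro cls_eqI) simp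
  then have "cls [(x, False)] \<otimes>\<^bsub>E\<^esub> cls [(x, True)] = \<one>\<^bsub>E\<^esub>"
    using w by (simp add: mult_cls one_cls)
  then show ?thesis
    by (rule E.inv_equality[symmetric]) (rule cls_closed[OF w])+
qed

lemma ext_square: "ext \<otimes>\<^bsub>E\<^esub> ext = elem z"
proof -
  have "cls [(Ext, True), (Ext, True)] = cls [(Elem z, True)]"
    using z_closed by (intro cls_relation) (auto simp: ext_relations_def words_over_def ext_generators_def)
  then show ?thesis
    by (simp add: elem_def ext_def mult_cls)
qed

lemma ext_inverts:
  assumes a: "a \<in> carrier A"
  shows "ext \<otimes>\<^bsub>E\<^esub> elem a = elem (inv a) \<otimes>\<^bsub>E\<^esub> ext"
proof -
  have "cls [(Ext, True), (Elem a, True), (Ext, False)] = cls [(Elem (inv a), True)]"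
    using a by (intro cls_relation) (auto simp: ext_relations_def words_over_def ext_generators_def)
  moreover have "cls [(Ext, True), (Elem a, True), (Ext, False)] =
      ext \<otimes>\<^bsub>E\<^esub> elem a \<otimes>\<^bsub>E\<^esub> inv\<^bsub>E\<^esub> ext"
  proof -
    have "inv\<^bsub>E\<^esub> ext = cls [(Ext, False)]"
      unfolding ext_def by (rule inv_letter[symmetric]) (simp add: ext_generators_def)
    moreover have "[(Ext, True), (Elem a, True)] \<in> words"
      using append_word[of "[(Ext, True)]" "[(Elem a, True)]"] a by simp
    ultimately show ?thesis
      using a by (simp add: ext_def elem_def mult_cls)
  qed
  ultimately have "elem (inv a) \<otimes>\<^bsub>E\<^esub> ext =
      ext \<otimes>\<^bsub>E\<^esub> elem a \<otimes>\<^bsub>E\<^esub> inv\<^bsub>E\<^esub> ext \<otimes>\<^bsub>E\<^esub> ext"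
    unfolding elem_def[of "inv a"] by (simp only:)
  also have "\<dots> = ext \<otimes>\<^bsub>E\<^esub> elem a"
    using elem_closed[OF a] ext_closed by (simp only: E.m_assoc E.inv_closed E.m_closed E.l_inv E.r_one)
  finally show ?thesis ..
qed

text \<open>On words, the homomorphism to the group of order 2 that kills \<open>A\<close>; it keeps
  \<open>ext\<close> out of the image of \<open>A\<close>.\<close>

definition parity :: "'a ext_gen word \<Rightarrow> bool" where
  "parity w = even (length (filter (\<lambda>l. fst l = Ext) w))"

lemma parity_invariant:
  "(v, w) \<in> word_rel (ext_generators A) (ext_relations A z) \<Longrightarrow> parity v = parity w"
  by (induction rule: word_rel.induct) (auto simp: parity_def ext_relations_def)

lemma ext_notin: "ext \<notin> elem ` carrier A"
proof
  assume "ext \<in> elem ` carrier A"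
  then obtain a where a: "a \<in> carrier A" "cls [(Ext, True)] = cls [(Elem a, True)]"
    by (auto simp: ext_def elem_def)
  have "([(Ext, True)], [(Elem a, True)]) \<in> word_rel (ext_generators A) (ext_relations A z)"
    using eq_equiv_class[OF a(2) equiv_word_rel letter_word(1)[OF a(1)]] by simp
  from parity_invariant[OF this] show False
    by (simp add: parity_def)
qed

lemma ext_inverse: "inv\<^bsub>E\<^esub> ext = elem z \<otimes>\<^bsub>E\<^esub> ext"
proof (rule E.inv_equality)
  have "elem z \<otimes>\<^bsub>E\<^esub> ext \<otimes>\<^bsub>E\<^esub> ext = elem z \<otimes>\<^bsub>E\<^esub> elem z"
    using z_closed by (simp add: E.m_assoc ext_square)
  then show "elem z \<otimes>\<^bsub>E\<^esub> ext \<otimes>\<^bsub>E\<^esub> ext = \<one>\<^bsub>E\<^esub>"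
    using z_closed by (simp add: elem_mult z_square)
qed (use z_closed in auto)

definition normal_forms :: "'a ext_gen word set set" where
  "normal_forms = elem ` carrier A \<union> (\<lambda>x. x \<otimes>\<^bsub>E\<^esub> ext) ` elem ` carrier A"

lemma normal_formsI:
  assumes "a \<in> carrier A"
  shows "elem a \<in> normal_forms" "elem a \<otimes>\<^bsub>E\<^esub> ext \<in> normal_forms"
  unfolding normal_forms_def
  by (rule UnI1[OF imageI[OF assms]])
    (rule UnI2[OF image_eqI[where f = "\<lambda>x. x \<otimes>\<^bsub>E\<^esub> ext", OF HOL.refl imageI[OF assms]]])

lemma normal_formsE:
  assumes "y \<in> normal_forms"
  obtains a where "a \<in> carrier A" "y = elem a" | a where "a \<in> carrier A" "y = elem a \<otimes>\<^bsub>E\<^esub> ext"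
  using assms unfolding normal_forms_def by (elim UnE imageE) simp_all

lemma elem_normal_forms:
  assumes a: "a \<in> carrier A" and y: "y \<in> normal_forms"
  shows "elem a \<otimes>\<^bsub>E\<^esub> y \<in> normal_forms"
  using y
proof (cases rule: normal_formsE)
  case (1 c)
  then show ?thesis
    using a normal_formsI(1)[of "a \<otimes> c"] by (simp add: elem_mult)
next
  case (2 c)
  then have "elem a \<otimes>\<^bsub>E\<^esub> y = elem (a \<otimes> c) \<otimes>\<^bsub>E\<^esub> ext"
    using a by (simp add: elem_mult[symmetric] E.m_assoc)
  then show ?thesis
    using a 2 normal_formsI(2)[of "a \<otimes> c"] by simp
qed

lemma ext_normal_forms:
  assumes y: "y \<in> normal_forms"
  shows "ext \<otimes>\<^bsub>E\<^esub> y \<in> normal_forms"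
  using y
proof (cases rule: normal_formsE)
  case (1 a)
  then show ?thesis
    using normal_formsI(2)[of "inv a"] by (simp add: ext_inverts)
next
  case (2 a)
  then have "ext \<otimes>\<^bsub>E\<^esub> y = ext \<otimes>\<^bsub>E\<^esub> elem a \<otimes>\<^bsub>E\<^esub> ext"
    by (simp add: E.m_assoc)
  also have "\<dots> = elem (inv a) \<otimes>\<^bsub>E\<^esub> (ext \<otimes>\<^bsub>E\<^esub> ext)"
    unfolding ext_inverts[OF 2(1)] using 2(1) by (simp add: E.m_assoc)
  also have "\<dots> = elem (inv a \<otimes> z)"
    using 2(1) z_closed by (simp add: ext_square elem_mult)
  finally show ?thesis
    using 2 z_closed normal_formsI(1)[of "inv a \<otimes> z"] by (simp only: inv_closed m_closed)
qed

lemma letter_normal_forms: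
  assumes x: "x \<in> ext_generators A" and y: "y \<in> normal_forms"
  shows "cls [(x, i)] \<otimes>\<^bsub>E\<^esub> y \<in> normal_forms"
proof -
  have y': "y \<in> carrier E"
    using y by (cases rule: normal_formsE) auto
  consider a where "a \<in> carrier A" "x = Elem a" | "x = Ext"
    using x unfolding ext_generators_def by blast
  then show ?thesis
  proof cases
    case (1 a)
    have "cls [(x, i)] = elem (if i then a else inv a)"
      using inv_letter[OF x] 1 by (cases i) (simp_all add: elem_def[of a, symmetric] elem.hom_inv)
    then show ?thesis
      using elem_normal_forms[OF _ y, of a] elem_normal_forms[OF _ y, of "inv a"] 1(1)
      by (cases i) simp_all
  next
    case 2
    show ?thesis
    proof (cases i)
      case True
      then show ?thesis
        using ext_normal_forms[OF y] 2 by (simp add: ext_def)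
    next
      case False
      then have "cls [(x, i)] = elem z \<otimes>\<^bsub>E\<^esub> ext"
        using inv_letter[OF x] 2 ext_inverse by (simp add: ext_def[symmetric])
      then have "cls [(x, i)] \<otimes>\<^bsub>E\<^esub> y = elem z \<otimes>\<^bsub>E\<^esub> (ext \<otimes>\<^bsub>E\<^esub> y)"
        using y' z_closed by (simp add: E.m_assoc)
      then show ?thesis
        using elem_normal_forms[OF z_closed ext_normal_forms[OF y]] by (simp only:)
    qed
  qed
qed

text \<open>Normal forms contain the class of the empty word and are closed under left
  multiplication by letters.\<close>

lemma carrier_E_normal_forms: "carrier E = normal_forms"
proof
  have "cls w \<in> normal_forms" if "w \<in> words" for w
    using that
  proof (induction w)
    case Nil
    have "cls [] = elem \<one>"
      unfolding elem.hom_one one_cls ..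
    then show ?case
      using normal_formsI(1)[OF one_closed] by (simp only:)
  next
    case (Cons l w)
    obtain x i where l: "l = (x, i)" by fastforce
    have w: "w \<in> words" and x: "x \<in> ext_generators A"
      using Cons.prems by (simp_all add: words_over_def l)
    have "cls (l # w) = cls [(x, i)] \<otimes>\<^bsub>E\<^esub> cls w"
      using mult_cls[of "[(x, i)]" w] w x by (simp add: words_over_def l)
    then show ?case
      using letter_normal_forms[OF x Cons.IH[OF w]] by (simp only:)
  qed
  then show "carrier E \<subseteq> normal_forms"
    unfolding carrier_E by blast
  show "normal_forms \<subseteq> carrier E"
    by (auto elim!: normal_formsE)
qed

lemma inversion_group_E: "inversion_group E (elem ` carrier A) ext"
proof (intro inversion_group.intro inversion_group_axioms.intro finite_group.intro finite_group_axioms.intro)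
  show "finite (carrier E)"
    unfolding carrier_E_normal_forms normal_forms_def using finite_A by simp
  show "subgroup (elem ` carrier A) E"
    by (rule elem.img_is_subgroup)
  show "carrier E = elem ` carrier A \<union> (\<lambda>x. x \<otimes>\<^bsub>E\<^esub> ext) ` elem ` carrier A"
    unfolding carrier_E_normal_forms normal_forms_def by (rule HOL.refl)
  show "ext \<otimes>\<^bsub>E\<^esub> ext \<in> elem ` carrier A"
    using z_closed by (simp add: ext_square)
  show "x \<otimes>\<^bsub>E\<^esub> y = y \<otimes>\<^bsub>E\<^esub> x" if "x \<in> elem ` carrier A" "y \<in> elem ` carrier A" for x y
    using that by (auto simp: elem_mult m_comm)
  show "ext \<otimes>\<^bsub>E\<^esub> x = inv\<^bsub>E\<^esub> x \<otimes>\<^bsub>E\<^esub> ext" if "x \<in> elem ` carrier A" for x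
    using that by (auto simp: ext_inverts elem.hom_inv)
qed (rule E.is_group ext_closed ext_notin)+

end

section \<open>From power sums to the distance\<close>

lemma (in inversion_group) lp_distance_mono:
  assumes q: "rate_collection G q" "symmetric_rates G q" and q': "symmetric_rates G q'"
    and le: "\<forall>s\<in>carrier G. q s \<le> q' s"
    and walk: "random_walk G q M X" and walk': "random_walk G q' M' X'"
    and t: "0 \<le> t" and m: "0 < m"
  shows "lp_distance G (2 * real m) M' X' t \<le> lp_distance G (2 * real m) M X t"
proof -
  have nonneg: "0 \<le> q s" if "s \<in> carrier G" for s
    using q(1) that unfolding rate_collection_def by simp
  have nonneg': "0 \<le> q' s" if "s \<in> carrier G" for s
    using nonneg[OF that] bspec[OF le that] by (rule order.trans)
  \<comment> \<open>The total rate of the larger collection, with time absorbed; it serves for both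
    walks.\<close>
  define k where "k = mass G (scale t q')"
  have k: "0 \<le> k"
    unfolding k_def mass_scale unfolding mass_def by (intro mult_nonneg_nonneg t sum_nonneg nonneg')
  obtain N where "clock_driven_walk M G q N X"
    using walk unfolding random_walk_def by (rule exE)
  then interpret W: finite_group_walk M G q N X
    by (intro finite_group_walk.intro finite_group_axioms)
  obtain N' where "clock_driven_walk M' G q' N' X'"
    using walk' unfolding random_walk_def by (rule exE)
  then interpret W': finite_group_walk M' G q' N' X'
    by (intro finite_group_walk.intro finite_group_axioms)
  have P: "walk_prob M X t x = walk_law G (scale t q + scale k (point \<one>)) x"
    "walk_prob M' X' t x = walk_law G (scale t q' + scale k (point \<one>)) x" if "x \<in> carrier G" for x
    by (rule W.walk_prob_eq[OF t k that nonneg]; assumption)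
      (rule W'.walk_prob_eq[OF t k that nonneg']; assumption)
  \<comment> \<open>Positivity of \<open>m\<close> matters at \<open>y = 0\<close>, since
    \<open>0 powr 0\<close> is 0 while \<open>0 ^ 0\<close> is 1.\<close>
  have powr: "\<bar>y\<bar> powr (2 * real m) = y ^ (2 * m)" for y
  proof -
    have "\<bar>y\<bar> powr (2 * real m) = \<bar>y\<bar> powr real (2 * m)" by simp
    also have "\<dots> = \<bar>y\<bar> ^ (2 * m)"
      using m by (intro powr_realpow') auto
    also have "\<dots> = y ^ (2 * m)"
      by (rule power_even_abs) simp
    finally show ?thesis .
  qed
  have "(\<Sum>x\<in>carrier G. (walk_law G (scale t q' + scale k (point \<one>)) x - 1 / real (order G)) ^ (2 * m))
    \<le> (\<Sum>x\<in>carrier G. (walk_law G (scale t q + scale k (point \<one>)) x - 1 / real (order G)) ^ (2 * m))"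
  proof (rule walk_law_power_sum_mono)
    fix x assume x: "x \<in> carrier G"
    show "0 \<le> scale t q x"
      unfolding scale_apply by (rule mult_nonneg_nonneg[OF t nonneg[OF x]])
    show "scale t q x \<le> scale t q' x"
      unfolding scale_apply by (rule mult_left_mono[OF bspec[OF le x] t])
    show "scale t q (inv x) = scale t q x" "scale t q' (inv x) = scale t q' x"
      using bspec[OF q(2)[unfolded symmetric_rates_def] x] bspec[OF q'[unfolded symmetric_rates_def] x]
      by (simp_all only: scale_apply)
  qed (simp_all add: k_def m)
  then have le: "(\<Sum>x\<in>carrier G. (walk_prob M' X' t x - 1 / real (order G)) ^ (2 * m))
    \<le> (\<Sum>x\<in>carrier G. (walk_prob M X t x - 1 / real (order G)) ^ (2 * m))"
    by (simp only: P cong: sum.cong)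
  show ?thesis
    unfolding lp_distance_def powr
  proof (rule powr_mono2[OF _ _ le])
    show "0 \<le> (\<Sum>x\<in>carrier G. (walk_prob M' X' t x - 1 / real (order G)) ^ (2 * m))"
      by (intro sum_nonneg zero_le_even_power')
  qed simp
qed

theorem theorem2:
  fixes A :: "('a, 'm) monoid_scheme" and z :: 'a and m :: nat
  assumes "comm_group A" and "finite (carrier A)"
    and "z \<in> carrier A" and "z \<otimes>\<^bsub>A\<^esub> z = \<one>\<^bsub>A\<^esub>"
    and "0 < m"
  shows "rate_monotonic TYPE('w) (inversion_extension A z) (2 * real m)"
proof -
  interpret inversion_presentation A z
    using assms by (simp add: inversion_presentation_def inversion_presentation_axioms_def)
  show ?thesis
    unfolding rate_monotonic_def
    by (intro allI impI inversion_group.lp_distance_mono[OF inversion_group_E]) (assumption | rule assms)+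
qed

end
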